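(* Consider the family of symmetrically coupled stochastic oscillators $$d\mathbf{X} = [\mathbf{f}(\mathbf{X}) + \tau\mathbf{u}_1(\mathbf{X}) + \kappa\mathbf{h}(\mathbf{X},\mathbf{Y})]dt + \mathbf{g}_1(\mathbf{X})d\mathbf{W}_1(t),\qquad d\mathbf{Y} = [\mathbf{f}(\mathbf{Y}) + \tau\mathbf{u}_2(\mathbf{Y}) +\kappa\mathbf{h}(\mathbf{Y},\mathbf{X})]dt + \mathbf{g}_2(\mathbf{Y})d\mathbf{W}_2(t)$$ on $\mathbb{R}^n\times\mathbb{R}^n$, with oscillators that are identical when unperturbed ($\mathbf{g}_1=\mathbf{g}_2$), and assume the coupled oscillator criteria (stated in the context) hold. Let $$\mathcal{M}(\kappa,\tau)=\begin{bmatrix}\iint P_{1x}[\tau\mathcal{L}_\tau^\dagger+\kappa\mathcal{L}_\kappa^\dagger]Q_{1x}^*\,d\mathbf{x}\,d\mathbf{y} & \iint P_{1x}[\tau\mathcal{L}_\tau^\dagger+\kappa\mathcal{L}_\kappa^\dagger]Q_{1y}^*\,d\mathbf{x}\,d\mathbf{y}\\ \iint P_{1y}[\tau\mathcal{L}_\tau^\dagger+\kappa\mathcal{L}_\kappa^\dagger]Q_{1x}^*\,d\mathbf{x}\,d\mathbf{y} & \iint P_{1y}[\tau\mathcal{L}_\tau^\dagger+\kappa\mathcal{L}_\kappa^\dagger]Q_{1y}^*\,d\mathbf{x}\,d\mathbf{y}\end{bmatrix}$$ (integrals over $\mathbb{R}^{2n}$), let $\Upsilon(\kappa,\tau)=\frac{\operatorname{trace}(\mathcal{M})}{2}$,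 and define the splitting discriminant $$\mathcal{D}(\kappa,\tau)=\sqrt{\operatorname{trace}(\mathcal{M})^2-4\det(\mathcal{M})}.$$ Assume that $$\beta=\iint_{\mathbb{R}^{2n}}d\mathbf{x}\,d\mathbf{y}\;P_{1x}(\mathbf{x},\mathbf{y})(\mathcal{L}_\kappa^\dagger Q_{1y}^*(\mathbf{x},\mathbf{y}))\neq0.$$ Fix $(\kappa^*,\tau^* )\in\mathcal{K}\times\mathcal{T}$ such that (for one of the choices of sign) $$\kappa^*=\mathfrak{K}(\tau^* )=\pm i|\tau^*|\,\frac{\sqrt{\left(\iint_{\mathbb{R}^{2n}}d\mathbf{x}\,d\mathbf{y}\;P_{1x}(\mathbf{x},\mathbf{y})[\mathcal{L}_\tau^\dagger Q_{1x}^*(\mathbf{x},\mathbf{y})]-P_{1y}(\mathbf{x},\mathbf{y})[\mathcal{L}_\tau^\dagger Q_{1y}^*(\mathbf{x},\mathbf{y})]\right)^2}}{2\beta}.$$ Then $\mathcal{D}(\mathfrak{K}(\tau^* ),\tau^* )=0$, and under the re-parameterization $(\kappa^*,\tau^* )\to(\epsilon\kappa^*,\epsilon\tau^* )$ the SKO eigenvalues $\lambda_\pm$ of the joint system are repeated with algebraic multiplicity $2$ to leading order in $\epsilon$: $$\lambda_+(\epsilon\kappa^*,\epsilon\tau^* )=\lambda_-(\epsilon\kappa^*,\epsilon\tau^* )=\lambda_1+\epsilon\,\Upsilon(\kappa^*,\tau^* )+\mathcal{O}(\epsilon^2)$$ (i.e. both eigenvalues have this same expansion to leading order in $\epsilo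n$).
   Context: Setting. The SDE is in the sense of It\^o; $\mathbf{f},\mathbf{u}_1,\mathbf{u}_2:\mathbb{R}^n\to\mathbb{R}^n$ and $\mathbf{h}:\mathbb{R}^n\times\mathbb{R}^n\to\mathbb{R}^n$ are $\mathcal{C}^2$ vector fields; $\mathbf{g}_1,\mathbf{g}_2$ are $n\times m$ matrices with $\mathcal{C}^2$ entries, nonsingular in the sense that $\mathbf{g}_i\mathbf{g}_i^T$ is nonsingular; the components of $d\mathbf{W}_1,d\mathbf{W}_2$ are increments of independent Wiener processes. $\kappa$ is the coupling strength and $\tau$ the detuning parameter. Operators. The backward operators (stochastic Koopman operators, SKO) are $\mathcal{L}_x^\dagger = \mathbf{f}(\mathbf{x})\cdot\nabla_x + \frac12\sum_{ij}[\mathbf{g}_1\mathbf{g}_1^T(\mathbf{x})]_{ij}\partial_{x_ix_j}$, $\mathcal{L}_y^\dagger = \mathbf{f}(\mathbf{y})\cdot\nabla_y + \frac12\sum_{ij}[\mathbf{g}_2\mathbf{g}_2^T(\mathbf{y})]_{ij}\partial_{y_iy_j}$, $\mathcal{L}_\tau^\dagger = \mathbf{u}_1(\mathbf{x})\cdot\nabla_x+\mathbf{u}_2(\mathbf{y})\cdot\nabla_y$, $\mathcal{L}_\kappa^\dagger=\mathbf{h}(\mathbf{x},\mathbf{y})\cdot\nabla_x+\mathbf{h}(\mathbf{y},\mathbf{x})\cdot\nabla_y$. The forward (Fokker-Planck) operators $\mathcal{L}_x,\mathcal{L}_y,\mathcal{L}_\tau,\mathcal{L}_\kappa$ are their formal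 adjoints with respect to the standard $L^2$ pairing. The joint backward operator (SKO of the joint system) is $\mathcal{L}_x^\dagger+\mathcal{L}_y^\dagger+\tau\mathcal{L}_\tau^\dagger+\kappa\mathcal{L}_\kappa^\dagger$ (and similarly for the forward operator). Forward operators act on $\mathcal{C}^2\cap L_1$ functions; backward operators act on $\mathcal{C}^2$ functions bounded on compact sets. Superscript $*$ on a function denotes complex conjugation; backward eigenfunctions are written $Q^*$. (On the parameters, $\kappa^*,\tau^*$ are simply names of particular parameter values.) Robustly oscillatory criteria (for a single oscillator): (1) all eigenvalues of the SKO apart from the stationary eigenvalue $\lambda_0=0$ have negative real parts; (2) the first nontrivial eigenvalue $\lambda_1=\mu\pm i\omega$ is a unique complex-conjugate pair with quality factor $|\omega/\mu|\gg1$; (3) all other eigenvalues $\lambda'$ have more negative real parts, $\Re[\lambda']<\upsilon\,\Re[\lambda_1]$ with $0<\upsilon\in\mathbb{R}$. The stationary distribution is unique. Coupled oscillator criteria: (A) When $\kappa=\tau=0$: each individual oscillator satisfies the robustly oscillatory criteria; the forward and backward operators of the isolated oscillators and of the joint system have a discrete eigenvalue spectrum (no accumulation point at zero) and a complete bi-orthonormal set of eigenfunctions, i.e. $\mathcal{L}P_\lambda=\lambda P_\lambda$, $\mathcal{L}^\dagger Q_\lambda^*=\lambda Q_\lambda^*$, $\int Q^*_\lambda P_{\lambda'}=\delta_{\lambda,\lambda'}$; the Fredholm alternative holds for both the forward and backward operators of the joint system (for an operator $L$ with adjoint $L^\dagger$: the solution of $Lu=f$ is unique iff $Lu=0$ has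 only the trivial solution, and a solution exists iff $\langle f,v\rangle=0$ for all $v$ with $L^\dagger v=0$). (B) There exist open sets $\mathcal{K},\mathcal{T}\subseteq\mathbb{R}$ containing $0$ such that for all $(\kappa,\tau)\in\mathcal{K}\times\mathcal{T}$: the joint system admits a unique stationary distribution, corresponding to the unique zero eigenvalue of its forward operator; this stationary distribution, evaluated at $(\epsilon\kappa,\epsilon\tau)$, has $\mathcal{C}^1$ dependence on $\epsilon$ for $|\epsilon|\le1$; and all other forward and backward eigenfunctions and corresponding eigenvalues, evaluated at $(\epsilon\kappa,\epsilon\tau)$, are also $\mathcal{C}^1$ in $\epsilon$ for $|\epsilon|\le1$. Unperturbed $Q$-functions. $P_0$ is the stationary density of an isolated oscillator. $\lambda_1=\mu+i\omega$ is the leading nontrivial eigenvalue (of a fixed sign of imaginary part) of the isolated oscillator, with backward eigenfunction $Q_1^*$ (the $Q$-function) and forward eigenfunction $P_1$, normalized so that $\int Q_1^*P_1=1$ and $Q_1^*$ has unit variance under $P_0$. For the joint identical system at $\kappa=\tau=0$ set $Q_{1x}^*(\mathbf{x},\mathbf{y})=Q_1^*(\mathbf{x})$, $Q_{1y}^*(\mathbf{x},\mathbf{y})=Q_1^*(\mathbf{y})$, $P_{1x}(\mathbf{x},\mathbf{y})=P_1(\mathbf{x})P_0(\mathbf{y})$, $P_{1y}(\mathbf{x},\mathbf{y})=P_1(\mathbf{y})P_0(\mathbf{x})$; $\lambda_1$ then has multiplicity $2$. Perturbed eigenvalues. $\mathcal{Q}_\pm^*(\mathbf{x},\mathbf{y};\kappa,\tau)$,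 with eigenvalues $\lambda_\pm(\kappa,\tau)$, denote the eigenfunctions of the joint backward operator that emanate from the two-dimensional $\lambda_1$-eigenspace at $\kappa=\tau=0$. *)

theory Defs
  imports "HOL-Analysis.Analysis" "HOL-Library.Landau_Symbols" "HOL-Library.Function_Algebras"
begin

section \<open>Function spaces\<close>

definition C1 :: "('a::euclidean_space \<Rightarrow> 'b::real_normed_vector) \<Rightarrow> bool" where
  "C1 f \<longleftrightarrow> (\<forall>z. f differentiable (at z)) \<and>
     (\<forall>v. continuous_on UNIV (\<lambda>z. frechet_derivative f (at z) v))"

definition C2 :: "('a::euclidean_space \<Rightarrow> 'b::real_normed_vector) \<Rightarrow> bool" where
  "C2 f \<longleftrightarrow> C1 f \<and> (\<forall>v. C1 (\<lambda>z. frechet_derivative f (at z) v))"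

definition backward_admissible :: "('z::euclidean_space \<Rightarrow> complex) \<Rightarrow> bool" where
  "backward_admissible u \<longleftrightarrow> C2 u \<and> (\<forall>K. compact K \<longrightarrow> bounded (u ` K))"

definition forward_admissible :: "('z::euclidean_space \<Rightarrow> complex) \<Rightarrow> bool" where
  "forward_admissible p \<longleftrightarrow> C2 p \<and> integrable lborel p"

definition cscale :: "complex \<Rightarrow> ('z \<Rightarrow> complex) \<Rightarrow> 'z \<Rightarrow> complex" where
  "cscale c u = (\<lambda>z. c * u z)"

record 'z normed_space =
  vecs :: "('z \<Rightarrow> complex) set"
  nrm :: "('z \<Rightarrow> complex) \<Rightarrow> real"

definition is_normed_space :: "'z normed_space \<Rightarrow> bool" where
  "is_normed_space V \<longleftrightarrow> module.subspace cscale (vecs V) \<and>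
     (\<forall>u\<in>vecs V. 0 \<le> nrm V u \<and> (nrm V u = 0 \<longleftrightarrow> u = 0)) \<and>
     (\<forall>c. \<forall>u\<in>vecs V. nrm V (cscale c u) = cmod c * nrm V u) \<and>
     (\<forall>u\<in>vecs V. \<forall>v\<in>vecs V. nrm V (u + v) \<le> nrm V u + nrm V v)"

definition bounded_operator ::
  "'z normed_space \<Rightarrow> 'z normed_space \<Rightarrow> (('z \<Rightarrow> complex) \<Rightarrow> 'z \<Rightarrow> complex) \<Rightarrow> bool" where
  "bounded_operator V W A \<longleftrightarrow>
     (\<forall>u\<in>vecs V. A u \<in> vecs W) \<and> (\<exists>C. \<forall>u\<in>vecs V. nrm W (A u) \<le> C * nrm V u)"

text \<open>The pairing is bilinear: backward functions are written \<open>Q\<^sup>*\<close>, that is, they already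
  carry the conjugation of the standard \<open>L\<^sup>2\<close> pairing.\<close>

definition pairing :: "('z::euclidean_space \<Rightarrow> complex) \<Rightarrow> ('z \<Rightarrow> complex) \<Rightarrow> complex" where
  "pairing u v = (LINT z|lborel. u z * v z)"

definition pairable :: "('z::euclidean_space \<Rightarrow> complex) \<Rightarrow> ('z \<Rightarrow> complex) \<Rightarrow> bool" where
  "pairable u v \<longleftrightarrow> integrable lborel (\<lambda>z. u z * v z)"

definition bounded_pairing :: "'z::euclidean_space normed_space \<Rightarrow> 'z normed_space \<Rightarrow> bool" where
  "bounded_pairing V W \<longleftrightarrow>
     (\<forall>u\<in>vecs V. \<forall>v\<in>vecs W. pairable u v) \<and>
     (\<exists>C. \<forall>u\<in>vecs V. \<forall>v\<in>vecs W. cmod (pairing u v) \<le> C * nrm V u * nrm W v)"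

text \<open>\<open>\<C>\<^sup>1\<close> dependence on \<open>\<epsilon> \<in> [-1, 1]\<close>, for scalars and for curves in a function space.\<close>

definition C1_scalar :: "(real \<Rightarrow> complex) \<Rightarrow> bool" where
  "C1_scalar l \<longleftrightarrow> (\<exists>l'. continuous_on {-1..1} l' \<and>
     (\<forall>\<epsilon>\<in>{-1..1}. (l has_vector_derivative l' \<epsilon>) (at \<epsilon> within {-1..1})))"

definition C1_curve :: "'z normed_space \<Rightarrow> (real \<Rightarrow> 'z \<Rightarrow> complex) \<Rightarrow> bool" where
  "C1_curve V u \<longleftrightarrow> (\<forall>\<epsilon>\<in>{-1..1}. u \<epsilon> \<in> vecs V) \<and>
     (\<exists>u'. (\<forall>\<epsilon>\<in>{-1..1}. u' \<epsilon> \<in> vecs V \<and>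
        ((\<lambda>\<eta>. nrm V (u \<eta> - u \<epsilon> - cscale (of_real (\<eta> - \<epsilon>)) (u' \<epsilon>)) / \<bar>\<eta> - \<epsilon>\<bar>) \<longlongrightarrow> 0)
          (at \<epsilon> within {-1..1}) \<and>
        ((\<lambda>\<eta>. nrm V (u' \<eta> - u' \<epsilon>)) \<longlongrightarrow> 0) (at \<epsilon> within {-1..1})))"

section \<open>The coupled system and its generators\<close>

text \<open>The Ito system enters through its generator. The field \<open>coupling\<close> is \<open>h\<close>, evaluated
  as \<open>h(x, y)\<close> in the equation for \<open>x\<close> and as \<open>h(y, x)\<close> in the equation for \<open>y\<close>.\<close>

record ('n, 'm) coupled_system =
  drift :: "real^'n \<Rightarrow> real^'n"
  detune_x :: "real^'n \<Rightarrow> real^'n"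
  detune_y :: "real^'n \<Rightarrow> real^'n"
  coupling :: "(real^'n) \<times> (real^'n) \<Rightarrow> real^'n"
  noise_x :: "real^'n \<Rightarrow> real^'m^'n"
  noise_y :: "real^'n \<Rightarrow> real^'m^'n"

definition noise_cov :: "(real^'n \<Rightarrow> real^'m^'n) \<Rightarrow> real^'n \<Rightarrow> real^'n^'n" where
  "noise_cov g x = g x ** transpose (g x)"

definition regular_system :: "('n::finite, 'm::finite) coupled_system \<Rightarrow> bool" where
  "regular_system S \<longleftrightarrow>
     C2 (drift S) \<and> C2 (detune_x S) \<and> C2 (detune_y S) \<and> C2 (coupling S) \<and>
     (\<forall>g\<in>{noise_x S, noise_y S}.
        (\<forall>i j. C2 (\<lambda>x. g x $ i $ j)) \<and> (\<forall>x. invertible (noise_cov g x)))"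

definition pd :: "'n::finite \<Rightarrow> (real^'n \<Rightarrow> complex) \<Rightarrow> real^'n \<Rightarrow> complex" where
  "pd i u x = frechet_derivative u (at x) (axis i 1)"

text \<open>\<open>b \<cdot> \<nabla>u\<close> and its formal adjoint \<open>-\<nabla> \<cdot> (b p)\<close>; then
  \<open>1/2 \<Sum>\<^sub>i\<^sub>j G\<^sub>i\<^sub>j \<partial>\<^sub>i\<partial>\<^sub>j u\<close> and its formal adjoint \<open>1/2 \<Sum>\<^sub>i\<^sub>j \<partial>\<^sub>i\<partial>\<^sub>j (G\<^sub>i\<^sub>j p)\<close>.\<close>

definition transport ::
  "(real^'n::finite \<Rightarrow> real^'n) \<Rightarrow> (real^'n \<Rightarrow> complex) \<Rightarrow> real^'n \<Rightarrow> complex" where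
  "transport b u x = (\<Sum>i\<in>UNIV. of_real (b x $ i) * pd i u x)"

definition transport_adj ::
  "(real^'n::finite \<Rightarrow> real^'n) \<Rightarrow> (real^'n \<Rightarrow> complex) \<Rightarrow> real^'n \<Rightarrow> complex" where
  "transport_adj b p x = - (\<Sum>i\<in>UNIV. pd i (\<lambda>x'. of_real (b x' $ i) * p x') x)"

definition diffusion ::
  "(real^'n::finite \<Rightarrow> real^'n^'n) \<Rightarrow> (real^'n \<Rightarrow> complex) \<Rightarrow> real^'n \<Rightarrow> complex" where
  "diffusion G u x =
     1/2 * (\<Sum>i\<in>UNIV. \<Sum>j\<in>UNIV. of_real (G x $ i $ j) * pd i (pd j u) x)"

definition diffusion_adj ::
  "(real^'n::finite \<Rightarrow> real^'n^'n) \<Rightarrow> (real^'n \<Rightarrow> complex) \<Rightarrow> real^'n \<Rightarrow> complex" where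
  "diffusion_adj G p x =
     1/2 * (\<Sum>i\<in>UNIV. \<Sum>j\<in>UNIV. pd i (pd j (\<lambda>x'. of_real (G x' $ i $ j) * p x')) x)"

definition osc_backward ::
  "(real^'n::finite \<Rightarrow> real^'n) \<Rightarrow> (real^'n \<Rightarrow> real^'m::finite^'n) \<Rightarrow>
   (real^'n \<Rightarrow> complex) \<Rightarrow> real^'n \<Rightarrow> complex" where
  "osc_backward f g u x = transport f u x + diffusion (noise_cov g) u x"

definition osc_forward ::
  "(real^'n::finite \<Rightarrow> real^'n) \<Rightarrow> (real^'n \<Rightarrow> real^'m::finite^'n) \<Rightarrow>
   (real^'n \<Rightarrow> complex) \<Rightarrow> real^'n \<Rightarrow> complex" where
  "osc_forward f g p x = transport_adj f p x + diffusion_adj (noise_cov g) p x"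

type_synonym 'n joint_op =
  "((real^'n) \<times> (real^'n) \<Rightarrow> complex) \<Rightarrow> (real^'n) \<times> (real^'n) \<Rightarrow> complex"

definition backward_x :: "('n::finite, 'm::finite) coupled_system \<Rightarrow> 'n joint_op" where
  "backward_x S u = (\<lambda>(x, y). osc_backward (drift S) (noise_x S) (\<lambda>x'. u (x', y)) x)"

definition backward_y :: "('n::finite, 'm::finite) coupled_system \<Rightarrow> 'n joint_op" where
  "backward_y S u = (\<lambda>(x, y). osc_backward (drift S) (noise_y S) (\<lambda>y'. u (x, y')) y)"

definition backward_\<tau> :: "('n::finite, 'm::finite) coupled_system \<Rightarrow> 'n joint_op" where
  "backward_\<tau> S u = (\<lambda>(x, y). transport (detune_x S) (\<lambda>x'. u (x', y)) x
                             + transport (detune_y S) (\<lambda>y'. u (x, y')) y)"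

definition backward_\<kappa> :: "('n::finite, 'm::finite) coupled_system \<Rightarrow> 'n joint_op" where
  "backward_\<kappa> S u = (\<lambda>(x, y). transport (\<lambda>x'. coupling S (x', y)) (\<lambda>x'. u (x', y)) x
                             + transport (\<lambda>y'. coupling S (y', x)) (\<lambda>y'. u (x, y')) y)"

definition forward_x :: "('n::finite, 'm::finite) coupled_system \<Rightarrow> 'n joint_op" where
  "forward_x S p = (\<lambda>(x, y). osc_forward (drift S) (noise_x S) (\<lambda>x'. p (x', y)) x)"

definition forward_y :: "('n::finite, 'm::finite) coupled_system \<Rightarrow> 'n joint_op" where
  "forward_y S p = (\<lambda>(x, y). osc_forward (drift S) (noise_y S) (\<lambda>y'. p (x, y')) y)"

definition forward_\<tau> :: "('n::finite, 'm::finite) coupled_system \<Rightarrow> 'n joint_op" where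
  "forward_\<tau> S p = (\<lambda>(x, y). transport_adj (detune_x S) (\<lambda>x'. p (x', y)) x
                            + transport_adj (detune_y S) (\<lambda>y'. p (x, y')) y)"

definition forward_\<kappa> :: "('n::finite, 'm::finite) coupled_system \<Rightarrow> 'n joint_op" where
  "forward_\<kappa> S p = (\<lambda>(x, y). transport_adj (\<lambda>x'. coupling S (x', y)) (\<lambda>x'. p (x', y)) x
                            + transport_adj (\<lambda>y'. coupling S (y', x)) (\<lambda>y'. p (x, y')) y)"

definition perturbation ::
  "('n::finite, 'm::finite) coupled_system \<Rightarrow> real \<Rightarrow> real \<Rightarrow> 'n joint_op" where
  "perturbation S \<kappa> \<tau> u z = of_real \<tau> * backward_\<tau> S u z + of_real \<kappa> * backward_\<kappa> S u z"

definition backward ::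
  "('n::finite, 'm::finite) coupled_system \<Rightarrow> real \<Rightarrow> real \<Rightarrow> 'n joint_op" where
  "backward S \<kappa> \<tau> u z = backward_x S u z + backward_y S u z + perturbation S \<kappa> \<tau> u z"

definition forward ::
  "('n::finite, 'm::finite) coupled_system \<Rightarrow> real \<Rightarrow> real \<Rightarrow> 'n joint_op" where
  "forward S \<kappa> \<tau> p z = forward_x S p z + forward_y S p z
     + of_real \<tau> * forward_\<tau> S p z + of_real \<kappa> * forward_\<kappa> S p z"

section \<open>Functional setting\<close>

text \<open>On all \<open>\<C>\<^sup>2\<close> functions, with no control at infinity, discreteness of the spectrum
  and the Fredholm alternative fail already in simple examples. The operators therefore act on unspecified
  subspaces of the \<open>\<C>\<^sup>2\<close> functions bounded on compact sets and of \<open>\<C>\<^sup>2 \<inter> L\<^sup>1\<close>,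
  with separate spaces for the right-hand sides (\<open>L u\<close> is only continuous for a
  \<open>\<C>\<^sup>2\<close> function \<open>u\<close>). The norms give a meaning to \<open>\<C>\<^sup>1\<close> dependence of
  eigenfunctions on a parameter.\<close>

record 'n function_setting =
  osc_bwd :: "(real^'n \<Rightarrow> complex) set"
  osc_fwd :: "(real^'n \<Rightarrow> complex) set"
  joint_bwd :: "((real^'n) \<times> (real^'n)) normed_space"
  joint_fwd :: "((real^'n) \<times> (real^'n)) normed_space"
  rhs_bwd :: "((real^'n) \<times> (real^'n)) normed_space"
  rhs_fwd :: "((real^'n) \<times> (real^'n)) normed_space"

definition admissible_setting ::
  "('n::finite, 'm::finite) coupled_system \<Rightarrow> 'n function_setting \<Rightarrow> bool" where
  "admissible_setting S X \<longleftrightarrow>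
     module.subspace cscale (osc_bwd X) \<and> (\<forall>u\<in>osc_bwd X. backward_admissible u) \<and>
     module.subspace cscale (osc_fwd X) \<and> (\<forall>p\<in>osc_fwd X. forward_admissible p) \<and>
     (\<forall>V\<in>{joint_bwd X, joint_fwd X, rhs_bwd X, rhs_fwd X}. is_normed_space V) \<and>
     (\<forall>u\<in>vecs (joint_bwd X). backward_admissible u) \<and>
     (\<forall>p\<in>vecs (joint_fwd X). forward_admissible p) \<and>
     (\<forall>u\<in>osc_bwd X. (\<lambda>(x, y). u x) \<in> vecs (joint_bwd X) \<and> (\<lambda>(x, y). u y) \<in> vecs (joint_bwd X)) \<and>
     (\<forall>p\<in>osc_fwd X. \<forall>q\<in>osc_fwd X. (\<lambda>(x, y). p x * q y) \<in> vecs (joint_fwd X)) \<and>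
     (\<forall>A\<in>{\<lambda>u. u, backward S 0 0, backward_\<tau> S, backward_\<kappa> S}.
        bounded_operator (joint_bwd X) (rhs_bwd X) A) \<and>
     (\<forall>A\<in>{\<lambda>p. p, forward S 0 0, forward_\<tau> S, forward_\<kappa> S}.
        bounded_operator (joint_fwd X) (rhs_fwd X) A) \<and>
     bounded_pairing (rhs_bwd X) (joint_fwd X) \<and>
     bounded_pairing (rhs_fwd X) (joint_bwd X)"

section \<open>Spectral notions\<close>

definition eigenspace ::
  "('z \<Rightarrow> complex) set \<Rightarrow> (('z \<Rightarrow> complex) \<Rightarrow> 'z \<Rightarrow> complex) \<Rightarrow> complex \<Rightarrow> ('z \<Rightarrow> complex) set" where
  "eigenspace D A l = {u \<in> D. A u = cscale l u}"

definition eigenvalues ::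
  "('z \<Rightarrow> complex) set \<Rightarrow> (('z \<Rightarrow> complex) \<Rightarrow> 'z \<Rightarrow> complex) \<Rightarrow> complex set" where
  "eigenvalues D A = {l. \<exists>u\<in>eigenspace D A l. u \<noteq> 0}"

definition multiplicity_of ::
  "('z \<Rightarrow> complex) set \<Rightarrow> (('z \<Rightarrow> complex) \<Rightarrow> 'z \<Rightarrow> complex) \<Rightarrow> complex \<Rightarrow> nat" where
  "multiplicity_of D A l = vector_space.dim cscale (eigenspace D A l)"

definition discrete_spectrum ::
  "('z \<Rightarrow> complex) set \<Rightarrow> (('z \<Rightarrow> complex) \<Rightarrow> 'z \<Rightarrow> complex) \<Rightarrow> bool" where
  "discrete_spectrum D A \<longleftrightarrow> discrete (eigenvalues D A) \<and> \<not> 0 islimpt eigenvalues D A"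

definition stationary_density ::
  "('z::euclidean_space \<Rightarrow> complex) set \<Rightarrow> (('z \<Rightarrow> complex) \<Rightarrow> 'z \<Rightarrow> complex) \<Rightarrow>
   ('z \<Rightarrow> complex) \<Rightarrow> bool" where
  "stationary_density D L p \<longleftrightarrow>
     p \<in> D \<and> (\<forall>z. p z \<in> \<real> \<and> 0 \<le> Re (p z)) \<and> (LINT z|lborel. p z) = 1 \<and> L p = 0"

definition complete_biorthonormal ::
  "('z::euclidean_space \<Rightarrow> complex) set \<Rightarrow> ('z \<Rightarrow> complex) set \<Rightarrow>
   (('z \<Rightarrow> complex) \<Rightarrow> 'z \<Rightarrow> complex) \<Rightarrow> (('z \<Rightarrow> complex) \<Rightarrow> 'z \<Rightarrow> complex) \<Rightarrow>
   (nat \<Rightarrow> complex) \<Rightarrow> (nat \<Rightarrow> 'z \<Rightarrow> complex) \<Rightarrow> (nat \<Rightarrow> 'z \<Rightarrow> complex) \<Rightarrow> bool" where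
  "complete_biorthonormal DB DF Lb Lf lam P Q \<longleftrightarrow>
     (\<forall>k. P k \<in> eigenspace DF Lf (lam k) \<and> Q k \<in> eigenspace DB Lb (lam k)) \<and>
     (\<forall>j k. pairable (Q j) (P k) \<and> pairing (Q j) (P k) = of_bool (j = k)) \<and>
     (\<forall>u\<in>DB. (\<forall>k. pairable u (P k) \<and> pairing u (P k) = 0) \<longrightarrow> u = 0) \<and>
     (\<forall>p\<in>DF. (\<forall>k. pairable (Q k) p \<and> pairing (Q k) p = 0) \<longrightarrow> p = 0)"

text \<open>\<open>D\<close> and \<open>Y\<close> are the domain of \<open>A\<close> and the space of right-hand sides,
  \<open>D'\<close> is the domain of the adjoint \<open>A'\<close>.\<close>

definition fredholm_alternative ::
  "('z::euclidean_space \<Rightarrow> complex) set \<Rightarrow> ('z \<Rightarrow> complex) set \<Rightarrow>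
   (('z \<Rightarrow> complex) \<Rightarrow> 'z \<Rightarrow> complex) \<Rightarrow>
   ('z \<Rightarrow> complex) set \<Rightarrow> (('z \<Rightarrow> complex) \<Rightarrow> 'z \<Rightarrow> complex) \<Rightarrow> bool" where
  "fredholm_alternative D Y A D' A' \<longleftrightarrow> (\<forall>f\<in>Y.
     ((\<exists>u\<in>D. A u = f) \<longrightarrow> ((\<exists>!u. u \<in> D \<and> A u = f) \<longleftrightarrow> (\<forall>u\<in>D. A u = 0 \<longrightarrow> u = 0))) \<and>
     ((\<exists>u\<in>D. A u = f) \<longleftrightarrow> (\<forall>v\<in>D'. A' v = 0 \<longrightarrow> pairing f v = 0)))"

section \<open>The criteria\<close>

text \<open>The quality factor condition \<open>|\<omega>/\<mu>| \<gg> 1\<close> has no numerical threshold; only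
  \<open>|\<omega>/\<mu>| > 1\<close> is required.\<close>

definition robustly_oscillatory ::
  "('z::euclidean_space \<Rightarrow> complex) set \<Rightarrow> ('z \<Rightarrow> complex) set \<Rightarrow>
   (('z \<Rightarrow> complex) \<Rightarrow> 'z \<Rightarrow> complex) \<Rightarrow> (('z \<Rightarrow> complex) \<Rightarrow> 'z \<Rightarrow> complex) \<Rightarrow> complex \<Rightarrow> bool" where
  "robustly_oscillatory DB DF Lb Lf l1 \<longleftrightarrow>
     0 \<in> eigenvalues DB Lb \<and> (\<forall>l\<in>eigenvalues DB Lb - {0}. Re l < 0) \<and>
     {l1, cnj l1} \<subseteq> eigenvalues DB Lb - {0} \<and>
     multiplicity_of DB Lb l1 = 1 \<and> multiplicity_of DB Lb (cnj l1) = 1 \<and>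
     Im l1 \<noteq> 0 \<and> \<bar>Im l1 / Re l1\<bar> > 1 \<and>
     (\<exists>\<upsilon>>0. \<forall>l\<in>eigenvalues DB Lb - {0, l1, cnj l1}. Re l < Re l1 \<and> Re l < \<upsilon> * Re l1) \<and>
     (\<exists>!p. stationary_density DF Lf p)"

definition coupled_criterion_A ::
  "('n::finite, 'm::finite) coupled_system \<Rightarrow> 'n function_setting \<Rightarrow> bool" where
  "coupled_criterion_A S X \<longleftrightarrow>
     (\<forall>g\<in>{noise_x S, noise_y S}. let Lb = osc_backward (drift S) g; Lf = osc_forward (drift S) g in
        (\<exists>l1. robustly_oscillatory (osc_bwd X) (osc_fwd X) Lb Lf l1) \<and>
        discrete_spectrum (osc_bwd X) Lb \<and> discrete_spectrum (osc_fwd X) Lf \<and>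
        (\<exists>lam P Q. complete_biorthonormal (osc_bwd X) (osc_fwd X) Lb Lf lam P Q)) \<and>
     discrete_spectrum (vecs (joint_bwd X)) (backward S 0 0) \<and>
     discrete_spectrum (vecs (joint_fwd X)) (forward S 0 0) \<and>
     (\<exists>lam P Q. complete_biorthonormal (vecs (joint_bwd X)) (vecs (joint_fwd X))
        (backward S 0 0) (forward S 0 0) lam P Q) \<and>
     (\<forall>l. fredholm_alternative
            (vecs (joint_bwd X)) (vecs (rhs_bwd X)) (\<lambda>u. backward S 0 0 u - cscale l u)
            (vecs (joint_fwd X)) (\<lambda>p. forward S 0 0 p - cscale l p) \<and>
          fredholm_alternative
            (vecs (joint_fwd X)) (vecs (rhs_fwd X)) (\<lambda>p. forward S 0 0 p - cscale l p)
            (vecs (joint_bwd X)) (\<lambda>u. backward S 0 0 u - cscale l u))"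

text \<open>The branches depend on the ray through \<open>(\<kappa>, \<tau>)\<close>: an eigenspace of dimension two at
  the origin is left, in general, through different vectors along different rays.\<close>

definition spectral_branches ::
  "('n::finite, 'm::finite) coupled_system \<Rightarrow> 'n function_setting \<Rightarrow> real \<Rightarrow> real \<Rightarrow>
   (nat \<Rightarrow> real \<Rightarrow> complex) \<Rightarrow> (nat \<Rightarrow> real \<Rightarrow> (real^'n) \<times> (real^'n) \<Rightarrow> complex) \<Rightarrow>
   (nat \<Rightarrow> real \<Rightarrow> (real^'n) \<times> (real^'n) \<Rightarrow> complex) \<Rightarrow> bool" where
  "spectral_branches S X \<kappa> \<tau> \<Lambda> P Q \<longleftrightarrow>
     (\<forall>k. C1_scalar (\<Lambda> k) \<and> C1_curve (joint_fwd X) (P k) \<and> C1_curve (joint_bwd X) (Q k)) \<and>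
     (\<forall>\<epsilon>\<in>{-1..1}.
        (\<forall>k. P k \<epsilon> \<in> eigenspace (vecs (joint_fwd X)) (forward S (\<epsilon> * \<kappa>) (\<epsilon> * \<tau>)) (\<Lambda> k \<epsilon>) - {0} \<and>
             Q k \<epsilon> \<in> eigenspace (vecs (joint_bwd X)) (backward S (\<epsilon> * \<kappa>) (\<epsilon> * \<tau>)) (\<Lambda> k \<epsilon>) - {0}) \<and>
        range (\<lambda>k. \<Lambda> k \<epsilon>) = eigenvalues (vecs (joint_fwd X)) (forward S (\<epsilon> * \<kappa>) (\<epsilon> * \<tau>)) - {0} \<and>
        range (\<lambda>k. \<Lambda> k \<epsilon>) = eigenvalues (vecs (joint_bwd X)) (backward S (\<epsilon> * \<kappa>) (\<epsilon> * \<tau>)) - {0})"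

definition coupled_criterion_B ::
  "('n::finite, 'm::finite) coupled_system \<Rightarrow> 'n function_setting \<Rightarrow> real set \<Rightarrow> real set \<Rightarrow> bool" where
  "coupled_criterion_B S X K T \<longleftrightarrow> open K \<and> open T \<and> 0 \<in> K \<and> 0 \<in> T \<and>
     (\<forall>\<kappa>\<in>K. \<forall>\<tau>\<in>T.
        (\<exists>!p. stationary_density (vecs (joint_fwd X)) (forward S \<kappa> \<tau>) p) \<and>
        multiplicity_of (vecs (joint_fwd X)) (forward S \<kappa> \<tau>) 0 = 1 \<and>
        (\<exists>p. C1_curve (joint_fwd X) p \<and> (\<forall>\<epsilon>\<in>{-1..1}.
           stationary_density (vecs (joint_fwd X)) (forward S (\<epsilon> * \<kappa>) (\<epsilon> * \<tau>)) (p \<epsilon>))) \<and>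
        (\<exists>\<Lambda> P Q. spectral_branches S X \<kappa> \<tau> \<Lambda> P Q))"

section \<open>Unperturbed and perturbed Q-functions\<close>

definition unit_variance :: "('z::euclidean_space \<Rightarrow> complex) \<Rightarrow> ('z \<Rightarrow> complex) \<Rightarrow> bool" where
  "unit_variance p q \<longleftrightarrow> (let m = pairing q p in
     pairable (\<lambda>z. of_real ((cmod (q z - m))\<^sup>2)) p \<and>
     pairing (\<lambda>z. of_real ((cmod (q z - m))\<^sup>2)) p = 1)"

text \<open>Index \<open>0\<close> is the stationary eigenvalue, index \<open>1\<close> the leading nontrivial one. The last
  conjunct says that \<open>lam 1\<close> is an eigenvalue of multiplicity two of the uncoupled pair.\<close>

definition unperturbed_modes ::
  "('n::finite, 'm::finite) coupled_system \<Rightarrow> 'n function_setting \<Rightarrow> (nat \<Rightarrow> complex) \<Rightarrow>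
   (nat \<Rightarrow> real^'n \<Rightarrow> complex) \<Rightarrow> (nat \<Rightarrow> real^'n \<Rightarrow> complex) \<Rightarrow> bool" where
  "unperturbed_modes S X lam P Q \<longleftrightarrow>
     (let Lb = osc_backward (drift S) (noise_x S); Lf = osc_forward (drift S) (noise_x S) in
        complete_biorthonormal (osc_bwd X) (osc_fwd X) Lb Lf lam P Q \<and>
        lam 0 = 0 \<and> stationary_density (osc_fwd X) Lf (P 0) \<and> Q 0 = 1 \<and>
        robustly_oscillatory (osc_bwd X) (osc_fwd X) Lb Lf (lam 1) \<and>
        unit_variance (P 0) (Q 1)) \<and>
     multiplicity_of (vecs (joint_bwd X)) (backward S 0 0) (lam 1) = 2"

definition perturbed_pair ::
  "('n::finite, 'm::finite) coupled_system \<Rightarrow> 'n function_setting \<Rightarrow> complex \<Rightarrow> real \<Rightarrow> real \<Rightarrow>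
   (real \<Rightarrow> real \<Rightarrow> complex) \<Rightarrow> (real \<Rightarrow> real \<Rightarrow> complex) \<Rightarrow>
   (real \<Rightarrow> real \<Rightarrow> (real^'n) \<times> (real^'n) \<Rightarrow> complex) \<Rightarrow>
   (real \<Rightarrow> real \<Rightarrow> (real^'n) \<times> (real^'n) \<Rightarrow> complex) \<Rightarrow> bool" where
  "perturbed_pair S X l1 \<kappa> \<tau> lp lm Qp Qm \<longleftrightarrow>
     (\<exists>\<Lambda> P Q i j. spectral_branches S X \<kappa> \<tau> \<Lambda> P Q \<and> i \<noteq> j \<and> {k. \<Lambda> k 0 = l1} = {i, j} \<and>
        (\<forall>\<epsilon>\<in>{-1..1}. lp (\<epsilon> * \<kappa>) (\<epsilon> * \<tau>) = \<Lambda> i \<epsilon> \<and> lm (\<epsilon> * \<kappa>) (\<epsilon> * \<tau>) = \<Lambda> j \<epsilon> \<and>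
                     Qp (\<epsilon> * \<kappa>) (\<epsilon> * \<tau>) = Q i \<epsilon> \<and> Qm (\<epsilon> * \<kappa>) (\<epsilon> * \<tau>) = Q j \<epsilon>))"

section \<open>The matrix M and the splitting discriminant\<close>

text \<open>Arguments \<open>P0\<close>, \<open>P1\<close>, \<open>Q1\<close> are the modes of a single oscillator.\<close>

definition Q1x :: "(real^'n \<Rightarrow> complex) \<Rightarrow> (real^'n) \<times> (real^'n) \<Rightarrow> complex" where
  "Q1x Q1 = (\<lambda>(x, y). Q1 x)"

definition Q1y :: "(real^'n \<Rightarrow> complex) \<Rightarrow> (real^'n) \<times> (real^'n) \<Rightarrow> complex" where
  "Q1y Q1 = (\<lambda>(x, y). Q1 y)"

definition P1x ::
  "(real^'n \<Rightarrow> complex) \<Rightarrow> (real^'n \<Rightarrow> complex) \<Rightarrow> (real^'n) \<times> (real^'n) \<Rightarrow> complex" where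
  "P1x P0 P1 = (\<lambda>(x, y). P1 x * P0 y)"

definition P1y ::
  "(real^'n \<Rightarrow> complex) \<Rightarrow> (real^'n \<Rightarrow> complex) \<Rightarrow> (real^'n) \<times> (real^'n) \<Rightarrow> complex" where
  "P1y P0 P1 = (\<lambda>(x, y). P1 y * P0 x)"

definition splitting_matrix ::
  "('n::finite, 'm::finite) coupled_system \<Rightarrow> (real^'n \<Rightarrow> complex) \<Rightarrow> (real^'n \<Rightarrow> complex) \<Rightarrow>
   (real^'n \<Rightarrow> complex) \<Rightarrow> real \<Rightarrow> real \<Rightarrow> complex^2^2" where
  "splitting_matrix S P0 P1 Q1 \<kappa> \<tau> = vector
     [vector [LINT z|lborel. P1x P0 P1 z * perturbation S \<kappa> \<tau> (Q1x Q1) z,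
              LINT z|lborel. P1x P0 P1 z * perturbation S \<kappa> \<tau> (Q1y Q1) z],
      vector [LINT z|lborel. P1y P0 P1 z * perturbation S \<kappa> \<tau> (Q1x Q1) z,
              LINT z|lborel. P1y P0 P1 z * perturbation S \<kappa> \<tau> (Q1y Q1) z]]"

definition Upsilon ::
  "('n::finite, 'm::finite) coupled_system \<Rightarrow> (real^'n \<Rightarrow> complex) \<Rightarrow> (real^'n \<Rightarrow> complex) \<Rightarrow>
   (real^'n \<Rightarrow> complex) \<Rightarrow> real \<Rightarrow> real \<Rightarrow> complex" where
  "Upsilon S P0 P1 Q1 \<kappa> \<tau> = trace (splitting_matrix S P0 P1 Q1 \<kappa> \<tau>) / 2"

definition splitting_discriminant ::
  "('n::finite, 'm::finite) coupled_system \<Rightarrow> (real^'n \<Rightarrow> complex) \<Rightarrow> (real^'n \<Rightarrow> complex) \<Rightarrow>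
   (real^'n \<Rightarrow> complex) \<Rightarrow> real \<Rightarrow> real \<Rightarrow> complex" where
  "splitting_discriminant S P0 P1 Q1 \<kappa> \<tau> =
     csqrt ((trace (splitting_matrix S P0 P1 Q1 \<kappa> \<tau>))\<^sup>2 - 4 * det (splitting_matrix S P0 P1 Q1 \<kappa> \<tau>))"

definition beta ::
  "('n::finite, 'm::finite) coupled_system \<Rightarrow> (real^'n \<Rightarrow> complex) \<Rightarrow> (real^'n \<Rightarrow> complex) \<Rightarrow>
   (real^'n \<Rightarrow> complex) \<Rightarrow> complex" where
  "beta S P0 P1 Q1 = (LINT z|lborel. P1x P0 P1 z * backward_\<kappa> S (Q1y Q1) z)"

text \<open>\<open>s\<close> is the choice of sign.\<close>

definition frak_K ::
  "complex \<Rightarrow> ('n::finite, 'm::finite) coupled_system \<Rightarrow> (real^'n \<Rightarrow> complex) \<Rightarrow>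
   (real^'n \<Rightarrow> complex) \<Rightarrow> (real^'n \<Rightarrow> complex) \<Rightarrow> real \<Rightarrow> complex" where
  "frak_K s S P0 P1 Q1 \<tau> = s * \<i> * of_real \<bar>\<tau>\<bar> *
     csqrt ((LINT z|lborel. P1x P0 P1 z * backward_\<tau> S (Q1x Q1) z
                          - P1y P0 P1 z * backward_\<tau> S (Q1y Q1) z)\<^sup>2) / (2 * beta S P0 P1 Q1)"

end

theory Submission
  imports Defs
begin

text \<open>Let \<open>A\<close> be the unperturbed backward operator, \<open>B\<close> the perturbation and \<open>u(\<epsilon>)\<close> a branch of
  eigenfunctions, \<open>(A + \<epsilon> B) u(\<epsilon>) = \<lambda>(\<epsilon>) u(\<epsilon>)\<close>. The Fredholm alternative makes the range of
  \<open>A - \<lambda>\<^sub>1\<close> orthogonal to \<open>P\<^sub>1\<^sub>x\<close> and \<open>P\<^sub>1\<^sub>y\<close>, so that \<open>(\<lambda>(\<epsilon>) - \<lambda>\<^sub>1) \<langle>u(\<epsilon>), P\<rangle> = \<epsilon> \<langle>B u(\<epsilon>), P\<rangle>\<close> for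
  both of them. Since \<open>u(0) = a Q\<^sub>1\<^sub>x + b Q\<^sub>1\<^sub>y\<close>, the limit \<open>\<epsilon> \<rightarrow> 0\<close> says that \<open>(a, b)\<close> is an eigenvector
  of \<open>M\<close>. Exchanging the two oscillators shows that \<open>M\<close> is symmetric with off-diagonal entry
  \<open>\<kappa> \<beta>\<close> and that the coupling cancels in \<open>M\<^sub>x\<^sub>x - M\<^sub>y\<^sub>y\<close>; the critical coupling is the value at which
  \<open>(M\<^sub>x\<^sub>x - M\<^sub>y\<^sub>y)\<^sup>2 + 4 (\<kappa> \<beta>)\<^sup>2\<close>, the discriminant of \<open>M\<close>, vanishes.\<close>

section \<open>Differentiation\<close>

text \<open>Existence of all first and second derivatives: the regularity that lets a scalar be
  pulled out of the second partial derivatives in \<open>diffusion_adj\<close>. It passes to sums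
  and products by the usual rules.\<close>

definition twice_differentiable :: "('a::euclidean_space \<Rightarrow> 'b::real_normed_vector) \<Rightarrow> bool" where
  "twice_differentiable f \<longleftrightarrow> (\<forall>z. f differentiable (at z)) \<and>
     (\<forall>v z. (\<lambda>z. frechet_derivative f (at z) v) differentiable (at z))"

lemma C2_twice_differentiable: "C2 f \<Longrightarrow> twice_differentiable f"
  by (simp add: C2_def C1_def twice_differentiable_def)

lemma twice_differentiable_const: "twice_differentiable (\<lambda>z. c)"
  by (simp add: twice_differentiable_def)

lemma twice_differentiable_add:
  assumes "twice_differentiable f" "twice_differentiable g"
  shows "twice_differentiable (\<lambda>z. f z + g z)"
proof -
  have df: "f differentiable (at z)" and dg: "g differentiable (at z)" for z
    using assms by (auto simp: twice_differentiable_def)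
  have "frechet_derivative (\<lambda>z. f z + g z) (at z)
      = (\<lambda>v. frechet_derivative f (at z) v + frechet_derivative g (at z) v)" for z
    using has_derivative_add[OF df[unfolded frechet_derivative_works] dg[unfolded frechet_derivative_works]]
    by (rule frechet_derivative_at[symmetric])
  then show ?thesis
    using assms by (auto simp: twice_differentiable_def)
qed

lemma twice_differentiable_sum:
  assumes "\<And>i. i \<in> I \<Longrightarrow> twice_differentiable (f i)"
  shows "twice_differentiable (\<lambda>z. \<Sum>i\<in>I. f i z)"
  using assms
  by (induction I rule: infinite_finite_induct)
    (auto intro: twice_differentiable_const twice_differentiable_add)

lemma twice_differentiable_mult:
  fixes f g :: "'a::euclidean_space \<Rightarrow> 'b::real_normed_algebra"
  assumes "twice_differentiable f" "twice_differentiable g"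
  shows "twice_differentiable (\<lambda>z. f z * g z)"
proof -
  have df: "f differentiable (at z)" and dg: "g differentiable (at z)" for z
    using assms by (auto simp: twice_differentiable_def)
  have "frechet_derivative (\<lambda>z. f z * g z) (at z)
      = (\<lambda>v. f z * frechet_derivative g (at z) v + frechet_derivative f (at z) v * g z)" for z
    using has_derivative_mult[OF df[unfolded frechet_derivative_works] dg[unfolded frechet_derivative_works]]
    by (rule frechet_derivative_at[symmetric])
  then show ?thesis
    using assms by (auto simp: twice_differentiable_def)
qed

lemma differentiable_of_real:
  fixes f :: "'a::real_normed_vector \<Rightarrow> real"
  assumes "f differentiable (at z)"
  shows "(\<lambda>z. of_real (f z) :: complex) differentiable (at z)"
  using assms unfolding differentiable_def by (blast intro: has_derivative_of_real)

lemma twice_differentiable_of_real: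
  fixes f :: "'a::euclidean_space \<Rightarrow> real"
  assumes "twice_differentiable f"
  shows "twice_differentiable (\<lambda>z. of_real (f z) :: complex)"
proof -
  have df: "f differentiable (at z)" for z
    using assms by (auto simp: twice_differentiable_def)
  have "frechet_derivative (\<lambda>z. of_real (f z) :: complex) (at z)
      = (\<lambda>v. of_real (frechet_derivative f (at z) v))" for z
    using has_derivative_of_real[OF df[unfolded frechet_derivative_works]]
    by (rule frechet_derivative_at[symmetric])
  then show ?thesis
    using assms by (auto simp: twice_differentiable_def intro: differentiable_of_real)
qed

lemma pd_const [simp]: "pd i (\<lambda>x. c) = (\<lambda>x. 0)"
  by (rule ext) (simp add: pd_def)

lemma pd_lincomb:
  assumes "u differentiable (at x)" "v differentiable (at x)"
  shows "pd i (\<lambda>x. a * u x + b * v x) x = a * pd i u x + b * pd i v x"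
proof -
  have "((\<lambda>x. a * u x + b * v x) has_derivative
     (\<lambda>h. a * frechet_derivative u (at x) h + b * frechet_derivative v (at x) h)) (at x)"
    using assms by (auto intro!: derivative_intros simp: frechet_derivative_works)
  from frechet_derivative_at[OF this, symmetric] show ?thesis
    by (simp add: pd_def)
qed

lemma pd_cmult:
  assumes "u differentiable (at x)"
  shows "pd i (\<lambda>x. a * u x) x = a * pd i u x"
  using pd_lincomb[OF assms assms, of i a 0] by simp

lemma transport_const [simp]: "transport b (\<lambda>x. c) x = 0"
  by (simp add: transport_def)

lemma osc_backward_const [simp]: "osc_backward f g (\<lambda>x. c) x = 0"
  by (simp add: osc_backward_def diffusion_def)

lemma transport_lincomb:
  assumes "u differentiable (at x)" "v differentiable (at x)"
  shows "transport f (\<lambda>x. a * u x + b * v x) x = a * transport f u x + b * transport f v x"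
  by (simp add: transport_def pd_lincomb[OF assms] sum_distrib_left sum.distrib algebra_simps)

lemma C2_component_differentiable:
  fixes f :: "real^'n::finite \<Rightarrow> real^'n"
  assumes "C2 f"
  shows "(\<lambda>x. f x $ i) differentiable (at x)"
proof -
  have "f differentiable (at x)"
    using assms by (simp add: C2_def C1_def)
  then obtain f' where "(f has_derivative f') (at x)"
    by (auto simp: differentiable_def)
  from bounded_linear.has_derivative[OF bounded_linear_vec_nth this] show ?thesis
    by (auto simp: differentiable_def)
qed

lemma twice_differentiable_noise_cov:
  fixes g :: "real^'n::finite \<Rightarrow> real^'m::finite^'n"
  assumes "\<And>i j. C2 (\<lambda>x. g x $ i $ j)"
  shows "twice_differentiable (\<lambda>x. noise_cov g x $ i $ j)"
  unfolding noise_cov_def matrix_matrix_mult_def transpose_def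
  by (simp, intro twice_differentiable_sum twice_differentiable_mult C2_twice_differentiable assms)

text \<open>On a product density the operator of one oscillator sees the factor of the other one as
  a constant. Differentiability matters because \<open>frechet_derivative\<close> is an arbitrary
  choice where no derivative exists.\<close>

lemma osc_forward_cmult:
  fixes f :: "real^'n::finite \<Rightarrow> real^'n" and g :: "real^'n \<Rightarrow> real^'m::finite^'n"
  assumes f: "C2 f" and g: "\<And>i j. C2 (\<lambda>x. g x $ i $ j)" and p: "C2 p"
  shows "osc_forward f g (\<lambda>x. c * p x) x = c * osc_forward f g p x"
proof -
  have dp: "p differentiable (at x)" for x
    using p by (simp add: C2_def C1_def)
  have "(\<lambda>x'. of_real (f x' $ i) * p x') differentiable (at x)" for i x
  proof -
    have "(\<lambda>x. of_real (f x $ i) :: complex) differentiable (at x)"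
      by (intro differentiable_of_real C2_component_differentiable f)
    then show ?thesis
      using dp by (rule differentiable_mult)
  qed
  then have transp: "pd i (\<lambda>x'. of_real (f x' $ i) * (c * p x')) x
      = c * pd i (\<lambda>x'. of_real (f x' $ i) * p x') x" for i x
    using pd_cmult[of "\<lambda>x'. of_real (f x' $ i) * p x'" x i c] by (simp add: mult.left_commute)
  have diff2: "twice_differentiable (\<lambda>x'. of_real (noise_cov g x' $ i $ j) * p x')" for i j
    by (intro twice_differentiable_mult twice_differentiable_of_real
        twice_differentiable_noise_cov g C2_twice_differentiable p)
  have "pd j (\<lambda>x'. of_real (noise_cov g x' $ i $ j) * (c * p x'))
      = (\<lambda>x. c * pd j (\<lambda>x'. of_real (noise_cov g x' $ i $ j) * p x') x)" for i j
    using diff2[of i j] pd_cmult[of "\<lambda>x'. of_real (noise_cov g x' $ i $ j) * p x'" _ j c]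
    by (auto simp: twice_differentiable_def mult.left_commute)
  moreover have "pd j (\<lambda>x'. of_real (noise_cov g x' $ i $ j) * p x') differentiable (at x)" for i j x
    using diff2[of i j] by (simp add: twice_differentiable_def pd_def[abs_def])
  ultimately have "pd i (pd j (\<lambda>x'. of_real (noise_cov g x' $ i $ j) * (c * p x'))) x
      = c * pd i (pd j (\<lambda>x'. of_real (noise_cov g x' $ i $ j) * p x')) x" for i j x
    by (simp add: pd_cmult)
  then show ?thesis
    by (simp add: osc_forward_def transport_adj_def diffusion_adj_def transp right_diff_distrib
        flip: sum_distrib_left)
qed

lemma differentiable_slices:
  fixes u :: "'a::real_normed_vector \<times> 'b::real_normed_vector \<Rightarrow> 'c::real_normed_vector"
  assumes "u differentiable (at (x, y))"
  shows "(\<lambda>x'. u (x', y)) differentiable (at x)" "(\<lambda>y'. u (x, y')) differentiable (at y)"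
proof -
  have "(u \<circ> (\<lambda>x'. (x', y))) differentiable (at x)"
    by (rule differentiable_chain_at)
      (use assms in \<open>auto simp: differentiable_def intro!: derivative_eq_intros\<close>)
  then show "(\<lambda>x'. u (x', y)) differentiable (at x)"
    by (simp add: o_def)
  have "(u \<circ> (\<lambda>y'. (x, y'))) differentiable (at y)"
    by (rule differentiable_chain_at)
      (use assms in \<open>auto simp: differentiable_def intro!: derivative_eq_intros\<close>)
  then show "(\<lambda>y'. u (x, y')) differentiable (at y)"
    by (simp add: o_def)
qed

lemma perturbation_lincomb:
  assumes "\<And>z. u differentiable (at z)" "\<And>z. v differentiable (at z)"
  shows "perturbation S \<kappa> \<tau> (\<lambda>z. a * u z + b * v z) z
    = a * perturbation S \<kappa> \<tau> u z + b * perturbation S \<kappa> \<tau> v z"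
  by (cases z) (simp add: perturbation_def backward_\<tau>_def backward_\<kappa>_def
      transport_lincomb differentiable_slices assms algebra_simps)

lemma backward_ray:
  "backward S (\<epsilon> * \<kappa>) (\<epsilon> * \<tau>) u z = backward S 0 0 u z + of_real \<epsilon> * perturbation S \<kappa> \<tau> u z"
  by (simp add: backward_def perturbation_def algebra_simps)

section \<open>Complex-valued functions as a vector space\<close>

interpretation cfun: vector_space "cscale :: complex \<Rightarrow> ('z \<Rightarrow> complex) \<Rightarrow> 'z \<Rightarrow> complex"
  by unfold_locales (auto simp: cscale_def algebra_simps)

text \<open>Otherwise \<open>{v, a, b}\<close> would be an independent set of three vectors in a set
  of dimension two.\<close>

lemma (in vector_space) two_independent_span:
  assumes dim: "dim V = 2" and "a \<in> V" "b \<in> V" "v \<in> V"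
    and indep: "independent {a, b}" and "a \<noteq> b"
  shows "v \<in> span {a, b}"
proof (rule ccontr)
  assume "v \<notin> span {a, b}"
  then have ind: "independent {v, a, b}" and "v \<notin> {a, b}"
    using indep by (auto simp: independent_insert intro: span_base)
  obtain B where B: "B \<subseteq> V" "independent B" "V \<subseteq> span B" "card B = dim V"
    by (rule basis_exists)
  \<comment> \<open>An infinite set has cardinality 0, so the value 2 forces finiteness.\<close>
  have "finite B"
    using B(4) dim by (intro card_ge_0_finite) simp
  then have "card {v, a, b} \<le> card B"
    using independent_span_bound[OF _ ind] B(3) assms by blast
  with \<open>v \<notin> {a, b}\<close> \<open>a \<noteq> b\<close> B(4) dim show False
    by simp
qed

section \<open>First-order perturbation of an eigenvalue\<close>

lemma tendsto_of_bigo: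
  fixes \<phi> :: "real \<Rightarrow> complex"
  assumes "(\<lambda>\<epsilon>. \<phi> \<epsilon> - a) \<in> O[at 0](of_real)"
  shows "(\<phi> \<longlongrightarrow> a) (at 0)"
proof -
  have "((\<lambda>\<epsilon>::real. of_real \<epsilon> :: complex) \<longlongrightarrow> 0) (at 0)"
    by (auto intro!: tendsto_eq_intros)
  then have "(of_real :: real \<Rightarrow> complex) \<in> o[at 0](\<lambda>_. 1)"
    by (intro smalloI_tendsto) auto
  with assms have "(\<lambda>\<epsilon>. \<phi> \<epsilon> - a) \<in> o[at 0](\<lambda>_. 1)"
    by (rule landau_o.big_small_trans)
  from smalloD_tendsto[OF this] show ?thesis
    by (simp add: LIM_zero_iff)
qed

text \<open>With \<open>\<mu> = \<lambda>(\<epsilon>) - \<lambda>\<^sub>1\<close>, \<open>\<phi>\<^sub>i = \<langle>u(\<epsilon>), P\<^sub>i\<rangle>\<close> and \<open>\<psi>\<^sub>i = \<langle>B u(\<epsilon>), P\<^sub>i\<rangle>\<close>: differentiability of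
  the eigenfunction alone already makes the remainder of the eigenvalue quadratic.\<close>

lemma quotient_expansion:
  fixes \<mu> \<phi> \<psi> :: "real \<Rightarrow> complex"
  assumes eq: "\<forall>\<^sub>F \<epsilon> in at 0. \<mu> \<epsilon> * \<phi> \<epsilon> = of_real \<epsilon> * \<psi> \<epsilon>"
    and \<phi>: "(\<lambda>\<epsilon>. \<phi> \<epsilon> - a) \<in> O[at 0](of_real)"
    and \<psi>: "(\<lambda>\<epsilon>. \<psi> \<epsilon> - d) \<in> O[at 0](of_real)"
    and a: "a \<noteq> 0" and d: "d = m * a"
  shows "(\<lambda>\<epsilon>. \<mu> \<epsilon> - of_real \<epsilon> * m) \<in> O[at 0](\<lambda>\<epsilon>. (of_real \<epsilon>)\<^sup>2)"
proof -
  have lim: "(\<phi> \<longlongrightarrow> a) (at 0)"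
    by (rule tendsto_of_bigo[OF \<phi>])
  have "(\<lambda>\<epsilon>. inverse (\<phi> \<epsilon>)) \<in> O[at 0](\<lambda>_. 1)"
    by (rule bigoI_tendsto[where c = "inverse a"]) (use lim a in \<open>auto intro: tendsto_inverse\<close>)
  moreover have "(\<lambda>\<epsilon>. m * (\<phi> \<epsilon> - a)) \<in> O[at 0](\<lambda>\<epsilon>. 1 * of_real \<epsilon>)"
    by (rule landau_o.big.mult[OF _ \<phi>]) simp
  then have "(\<lambda>\<epsilon>. (\<psi> \<epsilon> - d) - m * (\<phi> \<epsilon> - a)) \<in> O[at 0](of_real)"
    using sum_in_bigo(2)[OF \<psi>] by simp
  ultimately have "(\<lambda>\<epsilon>. of_real \<epsilon> * (((\<psi> \<epsilon> - d) - m * (\<phi> \<epsilon> - a)) * inverse (\<phi> \<epsilon>)))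
      \<in> O[at 0](\<lambda>\<epsilon>. of_real \<epsilon> * (of_real \<epsilon> * 1))"
    by (intro landau_o.big.mult) auto
  moreover have "\<forall>\<^sub>F \<epsilon> in at 0. \<phi> \<epsilon> \<noteq> 0"
    using lim a by (rule tendsto_imp_eventually_ne)
  \<comment> \<open>After division by \<open>\<phi>\<close> the leading terms cancel because
    \<open>d = m * a\<close>; what is left is \<open>of_real \<epsilon>\<close> times a quantity of
    order \<open>\<epsilon>\<close>.\<close>
  then have "\<forall>\<^sub>F \<epsilon> in at 0. \<mu> \<epsilon> - of_real \<epsilon> * m
      = of_real \<epsilon> * (((\<psi> \<epsilon> - d) - m * (\<phi> \<epsilon> - a)) * inverse (\<phi> \<epsilon>))"
    using eq
  proof eventually_elim
    case (elim \<epsilon>)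
    then have "\<mu> \<epsilon> = of_real \<epsilon> * \<psi> \<epsilon> / \<phi> \<epsilon>"
      by (simp add: field_simps)
    with elim d show ?case
      by (simp add: field_simps)
  qed
  ultimately show ?thesis
    by (simp add: landau_o.big.in_cong power2_eq_square)
qed

text \<open>The two identities for \<open>\<phi>\<close>, \<open>\<psi>\<close> force \<open>(a, b)\<close> to be an eigenvector of the symmetric matrix
  with rows \<open>(p, q)\<close> and \<open>(q, r)\<close>, whose only eigenvalue is \<open>(p + r) / 2\<close>.\<close>

lemma degenerate_expansion:
  fixes \<mu> \<phi>x \<phi>y \<psi>x \<psi>y :: "real \<Rightarrow> complex"
  assumes eqx: "\<forall>\<^sub>F \<epsilon> in at 0. \<mu> \<epsilon> * \<phi>x \<epsilon> = of_real \<epsilon> * \<psi>x \<epsilon>"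
    and eqy: "\<forall>\<^sub>F \<epsilon> in at 0. \<mu> \<epsilon> * \<phi>y \<epsilon> = of_real \<epsilon> * \<psi>y \<epsilon>"
    and \<phi>x: "(\<lambda>\<epsilon>. \<phi>x \<epsilon> - a) \<in> O[at 0](of_real)"
    and \<phi>y: "(\<lambda>\<epsilon>. \<phi>y \<epsilon> - b) \<in> O[at 0](of_real)"
    and \<psi>x: "(\<lambda>\<epsilon>. \<psi>x \<epsilon> - (a * p + b * q)) \<in> O[at 0](of_real)"
    and \<psi>y: "(\<lambda>\<epsilon>. \<psi>y \<epsilon> - (a * q + b * r)) \<in> O[at 0](of_real)"
    and nz: "a \<noteq> 0 \<or> b \<noteq> 0" and disc: "(p - r)\<^sup>2 + 4 * q\<^sup>2 = 0"
  shows "(\<lambda>\<epsilon>. \<mu> \<epsilon> - of_real \<epsilon> * ((p + r) / 2)) \<in> O[at 0](\<lambda>\<epsilon>. (of_real \<epsilon>)\<^sup>2)"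
proof -
  have "((\<lambda>\<epsilon>. \<phi>x \<epsilon> * \<psi>y \<epsilon> - \<phi>y \<epsilon> * \<psi>x \<epsilon>)
      \<longlongrightarrow> a * (a * q + b * r) - b * (a * p + b * q)) (at 0)"
    by (intro tendsto_intros tendsto_of_bigo \<phi>x \<phi>y \<psi>x \<psi>y)
  \<comment> \<open>This eliminates \<open>\<mu>\<close>: after multiplication by
    \<open>of_real \<epsilon>\<close> both products equal
    \<open>\<mu> \<epsilon> * \<phi>x \<epsilon> * \<phi>y \<epsilon>\<close>.\<close>
  moreover have "\<forall>\<^sub>F \<epsilon> in at 0. \<phi>x \<epsilon> * \<psi>y \<epsilon> - \<phi>y \<epsilon> * \<psi>x \<epsilon> = 0"
    using eqx eqy eventually_neq_at_within[of 0]
  proof eventually_elim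
    case (elim \<epsilon>)
    have "of_real \<epsilon> * (\<phi>x \<epsilon> * \<psi>y \<epsilon> - \<phi>y \<epsilon> * \<psi>x \<epsilon>)
        = \<phi>x \<epsilon> * (of_real \<epsilon> * \<psi>y \<epsilon>) - \<phi>y \<epsilon> * (of_real \<epsilon> * \<psi>x \<epsilon>)"
      by (simp add: algebra_simps)
    also have "\<dots> = 0"
      by (simp flip: elim(1,2))
    finally have "of_real \<epsilon> * (\<phi>x \<epsilon> * \<psi>y \<epsilon> - \<phi>y \<epsilon> * \<psi>x \<epsilon>) = 0" .
    with elim show ?case
      by simp
  qed
  ultimately have "((\<lambda>\<epsilon>. 0) \<longlongrightarrow> a * (a * q + b * r) - b * (a * p + b * q)) (at (0 :: real))"
    by (rule Lim_transform_eventually)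
  then have par: "a * (a * q + b * r) - b * (a * p + b * q) = 0"
    by (metis LIM_const_eq)
  \<comment> \<open>The two expressions being squared are twice the components of the matrix minus
    \<open>(p + r) / 2\<close>, applied to \<open>(a, b)\<close>. Their squares are combinations of
    the discriminant and of the expression in \<open>par\<close>, both of which are zero.\<close>
  have "((p - r) * a + 2 * q * b)\<^sup>2
      = a\<^sup>2 * ((p - r)\<^sup>2 + 4 * q\<^sup>2) - 4 * q * (a * (a * q + b * r) - b * (a * p + b * q))"
    by (simp add: power2_eq_square algebra_simps)
  moreover have "((r - p) * b + 2 * q * a)\<^sup>2
      = b\<^sup>2 * ((p - r)\<^sup>2 + 4 * q\<^sup>2) + 4 * q * (a * (a * q + b * r) - b * (a * p + b * q))"
    by (simp add: power2_eq_square algebra_simps)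
  ultimately have "(p - r) * a + 2 * q * b = 0" "(r - p) * b + 2 * q * a = 0"
    unfolding par disc by simp_all
  moreover have "a * p + b * q - (p + r) / 2 * a = ((p - r) * a + 2 * q * b) / 2"
    "a * q + b * r - (p + r) / 2 * b = ((r - p) * b + 2 * q * a) / 2"
    by (simp_all add: field_simps)
  ultimately have "a * p + b * q = (p + r) / 2 * a" "a * q + b * r = (p + r) / 2 * b"
    by simp_all
  \<comment> \<open>Division is possible by whichever of the two pairings has a nonzero
    limit.\<close>
  then show ?thesis
    using nz quotient_expansion[OF eqx \<phi>x \<psi>x] quotient_expansion[OF eqy \<phi>y \<psi>y] by blast
qed

section \<open>Differentiable curves in function spaces and their pairings\<close>

lemma nrm_triangle:
  "is_normed_space V \<Longrightarrow> u \<in> vecs V \<Longrightarrow> v \<in> vecs V \<Longrightarrow> nrm V (u + v) \<le> nrm V u + nrm V v"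
  by (simp add: is_normed_space_def)

text \<open>Near 0 the first-order remainder has norm at most the absolute value of
  \<open>\<epsilon>\<close>, so one plus the norm of the derivative at 0 serves as the
  constant.\<close>

lemma C1_curve_differentiable_at_0:
  assumes V: "is_normed_space V" and u: "C1_curve V u"
  shows "\<exists>C\<ge>0. \<forall>\<^sub>F \<epsilon> in at 0. nrm V (u \<epsilon> - u 0) \<le> C * \<bar>\<epsilon>\<bar>"
proof -
  obtain du where du: "\<forall>\<epsilon>\<in>{-1..1}. du \<epsilon> \<in> vecs V \<and>
      ((\<lambda>\<eta>. nrm V (u \<eta> - u \<epsilon> - cscale (of_real (\<eta> - \<epsilon>)) (du \<epsilon>)) / \<bar>\<eta> - \<epsilon>\<bar>) \<longlongrightarrow> 0)
        (at \<epsilon> within {-1..1})"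
    using u unfolding C1_curve_def by blast
  define u' where "u' = du 0"
  have u': "u' \<in> vecs V"
    and lim: "((\<lambda>\<eta>. nrm V (u \<eta> - u 0 - cscale (of_real \<eta>) u') / \<bar>\<eta>\<bar>) \<longlongrightarrow> 0) (at 0)"
    using du[rule_format, of 0] by (simp_all add: u'_def at_within_Icc_at)
  have sub: "cfun.subspace (vecs V)" and nn: "0 \<le> nrm V u'"
    using V u' by (auto simp: is_normed_space_def)
  have "\<forall>\<^sub>F \<epsilon> in at 0. nrm V (u \<epsilon> - u 0 - cscale (of_real \<epsilon>) u') / \<bar>\<epsilon>\<bar> < 1"
    using lim by (rule order_tendstoD) simp
  moreover have "\<forall>\<^sub>F \<epsilon> in at 0. \<epsilon> \<in> {-1<..<1::real}"
    by (rule eventually_at_in_open') auto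
  ultimately have "\<forall>\<^sub>F \<epsilon> in at 0. nrm V (u \<epsilon> - u 0) \<le> (1 + nrm V u') * \<bar>\<epsilon>\<bar>"
    using eventually_neq_at_within[of 0]
  proof eventually_elim
    case (elim \<epsilon>)
    let ?r = "u \<epsilon> - u 0 - cscale (of_real \<epsilon>) u'" and ?s = "cscale (of_real \<epsilon>) u'"
    have mem: "?s \<in> vecs V" "u \<epsilon> - u 0 \<in> vecs V"
      using elim u u' unfolding C1_curve_def
      by (auto intro!: cfun.subspace_scale[OF sub] cfun.subspace_diff[OF sub])
    have "nrm V (?r + ?s) \<le> nrm V ?r + nrm V ?s"
      by (intro nrm_triangle V mem cfun.subspace_diff[OF sub])
    moreover have "nrm V ?s = \<bar>\<epsilon>\<bar> * nrm V u'"
      using V u' by (simp add: is_normed_space_def)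
    moreover have "nrm V ?r \<le> \<bar>\<epsilon>\<bar>"
      using elim by (simp add: field_simps)
    ultimately show ?case
      by (simp add: algebra_simps)
  qed
  with nn show ?thesis
    by (intro exI[of _ "1 + nrm V u'"]) auto
qed

lemma pairing_diff:
  assumes "pairable f v" "pairable g v"
  shows "pairing (f - g) v = pairing f v - pairing g v"
  using assms unfolding pairable_def pairing_def by (simp add: left_diff_distrib)

lemma pairing_lincomb:
  assumes "pairable f v" "pairable g v"
  shows "pairing (\<lambda>z. a * f z + b * g z) v = a * pairing f v + b * pairing g v"
  using assms unfolding pairable_def pairing_def by (simp add: distrib_right mult.assoc)

text \<open>The linear bound on \<open>u \<epsilon> - u 0\<close> survives a bounded operator and a
  bounded pairing. Additivity of \<open>A\<close> is asked for on \<open>vecs V\<close> alone, since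
  differential operators built on \<open>frechet_derivative\<close> are additive only on
  differentiable functions.\<close>

lemma pairing_curve_bigo:
  assumes V: "is_normed_space V" and W: "is_normed_space W" and Z: "is_normed_space Z"
    and A: "bounded_operator V W A" and WZ: "bounded_pairing W Z"
    and diff: "\<And>f g. f \<in> vecs V \<Longrightarrow> g \<in> vecs V \<Longrightarrow> A (f - g) = A f - A g"
    and u: "C1_curve V u" and v: "v \<in> vecs Z"
  shows "(\<lambda>\<epsilon>. pairing (A (u \<epsilon>)) v - pairing (A (u 0)) v) \<in> O[at 0](of_real)"
proof -
  obtain C where C: "C \<ge> 0" "\<forall>\<^sub>F \<epsilon> in at 0. nrm V (u \<epsilon> - u 0) \<le> C * \<bar>\<epsilon>\<bar>"
    using C1_curve_differentiable_at_0[OF V u] by blast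
  obtain CA where CA: "\<And>f. f \<in> vecs V \<Longrightarrow> nrm W (A f) \<le> CA * nrm V f"
    using A by (auto simp: bounded_operator_def)
  obtain CP where "\<forall>f\<in>vecs W. \<forall>v\<in>vecs Z. cmod (pairing f v) \<le> CP * nrm W f * nrm Z v"
    using WZ unfolding bounded_pairing_def by blast
  then have CP: "cmod (pairing f v) \<le> CP * nrm W f * nrm Z v" if "f \<in> vecs W" for f
    using that v by blast
  have "\<forall>\<^sub>F \<epsilon> in at 0. \<epsilon> \<in> {-1<..<1::real}"
    by (rule eventually_at_in_open') auto
  with C(2) have "\<forall>\<^sub>F \<epsilon> in at 0. norm (pairing (A (u \<epsilon>)) v - pairing (A (u 0)) v)
      \<le> (\<bar>CP\<bar> * (\<bar>CA\<bar> * C) * nrm Z v) * norm (of_real \<epsilon> :: complex)"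
  proof eventually_elim
    case (elim \<epsilon>)
    have mem: "u \<epsilon> \<in> vecs V" "u 0 \<in> vecs V"
      using u elim by (auto simp: C1_curve_def)
    then have d: "u \<epsilon> - u 0 \<in> vecs V"
      using V by (auto simp: is_normed_space_def intro: cfun.subspace_diff)
    have Amem: "A f \<in> vecs W" if "f \<in> vecs V" for f
      using that A by (auto simp: bounded_operator_def)
    have pos: "0 \<le> nrm V (u \<epsilon> - u 0)" "0 \<le> nrm Z v" "0 \<le> nrm W (A (u \<epsilon> - u 0))"
      using V Z W d v Amem by (auto simp: is_normed_space_def)
    have "norm (pairing (A (u \<epsilon>)) v - pairing (A (u 0)) v) = cmod (pairing (A (u \<epsilon> - u 0)) v)"
      using WZ mem v Amem by (simp add: diff pairing_diff bounded_pairing_def)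
    also have "\<dots> \<le> CP * nrm W (A (u \<epsilon> - u 0)) * nrm Z v"
      by (rule CP[OF Amem[OF d]])
    \<comment> \<open>Absolute values, because the constants of \<open>bounded_operator\<close> and
      \<open>bounded_pairing\<close> carry no sign condition.\<close>
    also have "\<dots> \<le> \<bar>CP\<bar> * (\<bar>CA\<bar> * (C * \<bar>\<epsilon>\<bar>)) * nrm Z v"
    proof (intro mult_right_mono mult_mono)
      have "nrm W (A (u \<epsilon> - u 0)) \<le> \<bar>CA\<bar> * nrm V (u \<epsilon> - u 0)"
        using CA[OF d] pos(1) by (meson abs_ge_self mult_right_mono order_trans)
      also have "\<dots> \<le> \<bar>CA\<bar> * (C * \<bar>\<epsilon>\<bar>)"
        using elim by (intro mult_left_mono) auto
      finally show "nrm W (A (u \<epsilon> - u 0)) \<le> \<bar>CA\<bar> * (C * \<bar>\<epsilon>\<bar>)" .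
    qed (use pos in auto)
    finally show ?case
      by (simp add: mult_ac)
  qed
  then show ?thesis
    by (rule bigoI)
qed

section \<open>Integrals over the product of two copies of the space\<close>

lemma integral_swap:
  fixes f :: "(real^'n::finite) \<times> (real^'n) \<Rightarrow> complex"
  assumes "integrable lborel f"
  shows "(LINT z|lborel. f (snd z, fst z)) = (LINT z|lborel. f z)"
proof -
  have "(\<lambda>z. f (snd z, fst z)) = (\<lambda>(x, y). f (y, x))"
    by auto
  then show ?thesis
    using assms lborel_pair.integral_product_swap[of f] by (simp add: lborel_prod)
qed

text \<open>Fubini's theorem. Integrability on the product suffices, since constant factors leave
  the inner and the outer integral unconditionally.\<close>

lemma integral_separated:
  fixes f :: "(real^'n::finite) \<times> (real^'n) \<Rightarrow> complex"
  assumes "integrable lborel f" and f: "\<And>x y. f (x, y) = a x * b y"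
  shows "(LINT z|lborel. f z) = (LINT x|lborel. a x) * (LINT y|lborel. b y)"
proof -
  have "(LINT z|lborel. f z) = (LINT x|lborel. LINT y|lborel. f (x, y))"
    using assms(1) lborel_pair.integral_fst'[of f] by (simp add: lborel_prod)
  also have "\<dots> = (LINT x|lborel. a x) * (LINT y|lborel. b y)"
    by (simp add: f)
  finally show ?thesis .
qed

section \<open>The degenerate eigenspace of two identical oscillators\<close>

locale identical_oscillators =
  fixes S :: "('n::finite, 'm::finite) coupled_system"
    and X :: "'n function_setting"
    and lam :: "nat \<Rightarrow> complex"
    and P Q :: "nat \<Rightarrow> real^'n \<Rightarrow> complex"
  assumes regular: "regular_system S"
    and identical: "noise_x S = noise_y S"
    and setting: "admissible_setting S X"
    and criterion_A: "coupled_criterion_A S X"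
    and modes: "unperturbed_modes S X lam P Q"
begin

text \<open>Keeps the index in \<open>lam 1\<close>, \<open>P 1\<close> and \<open>Q 1\<close> from
  being rewritten to \<open>Suc 0\<close>.\<close>

declare One_nat_def [simp del]

abbreviation "px \<equiv> P1x (P 0) (P 1)"
abbreviation "py \<equiv> P1y (P 0) (P 1)"
abbreviation "qx \<equiv> Q1x (Q 1)"
abbreviation "qy \<equiv> Q1y (Q 1)"

section \<open>Modes of one oscillator and bounds in the function spaces\<close>

lemma modes_biorthonormal:
  "complete_biorthonormal (osc_bwd X) (osc_fwd X)
    (osc_backward (drift S) (noise_x S)) (osc_forward (drift S) (noise_x S)) lam P Q"
  and modes_0: "lam 0 = 0" "Q 0 = 1" "(LINT x|lborel. P 0 x) = 1"
  and multiplicity_2: "multiplicity_of (vecs (joint_bwd X)) (backward S 0 0) (lam 1) = 2"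
  using modes unfolding unperturbed_modes_def Let_def stationary_density_def by blast+

lemma modes_mem: "P k \<in> osc_fwd X" "Q k \<in> osc_bwd X"
  using modes_biorthonormal by (auto simp: complete_biorthonormal_def eigenspace_def)

lemma modes_eigen:
  "osc_forward (drift S) (noise_x S) (P k) x = lam k * P k x"
  "osc_backward (drift S) (noise_x S) (Q k) x = lam k * Q k x"
  using modes_biorthonormal
  by (auto simp: complete_biorthonormal_def eigenspace_def cscale_def)

lemma modes_pairing: "(LINT x|lborel. Q j x * P k x) = of_bool (j = k)"
  using modes_biorthonormal by (auto simp: complete_biorthonormal_def pairing_def)

text \<open>Biorthogonality with the constant mode \<open>Q 0 = 1\<close>. This zero mass is what
  makes the cross terms below vanish.\<close>

lemma integral_P1: "(LINT x|lborel. P 1 x) = 0"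
  using modes_pairing[of 0 1] modes_0(2) by simp

lemma P_C2: "C2 (P k)"
  using setting modes_mem by (auto simp: admissible_setting_def forward_admissible_def)

lemma normed_spaces:
  "is_normed_space (joint_bwd X)" "is_normed_space (joint_fwd X)"
  "is_normed_space (rhs_bwd X)"
  using setting by (auto simp: admissible_setting_def)

lemma joint_differentiable: "u \<in> vecs (joint_bwd X) \<Longrightarrow> u differentiable (at z)"
proof -
  assume "u \<in> vecs (joint_bwd X)"
  with setting have "backward_admissible u"
    unfolding admissible_setting_def by blast
  then show ?thesis
    unfolding backward_admissible_def C2_def C1_def by blast
qed

lemma bounded_operators:
  "bounded_operator (joint_bwd X) (rhs_bwd X) (\<lambda>u. u)"
  "bounded_operator (joint_bwd X) (rhs_bwd X) (backward S 0 0)"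
  "bounded_operator (joint_bwd X) (rhs_bwd X) (backward_\<tau> S)"
  "bounded_operator (joint_bwd X) (rhs_bwd X) (backward_\<kappa> S)"
  using setting by (auto simp: admissible_setting_def)

lemma rhs_mem:
  assumes "u \<in> vecs (joint_bwd X)"
  shows "u \<in> vecs (rhs_bwd X)" "backward S 0 0 u \<in> vecs (rhs_bwd X)"
    "backward_\<tau> S u \<in> vecs (rhs_bwd X)" "backward_\<kappa> S u \<in> vecs (rhs_bwd X)"
  using bounded_operators assms by (auto simp: bounded_operator_def)

lemma bounded_pairing_bwd: "bounded_pairing (rhs_bwd X) (joint_fwd X)"
  using setting by (auto simp: admissible_setting_def)

lemma pairable_mem:
  "f \<in> vecs (rhs_bwd X) \<Longrightarrow> v \<in> vecs (joint_fwd X) \<Longrightarrow> pairable f v"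
  using bounded_pairing_bwd by (auto simp: bounded_pairing_def)

lemma bounded_perturbation: "bounded_operator (joint_bwd X) (rhs_bwd X) (perturbation S \<kappa> \<tau>)"
proof -
  let ?V = "joint_bwd X" and ?W = "rhs_bwd X"
  have eq: "perturbation S \<kappa> \<tau> u
      = cscale (of_real \<tau>) (backward_\<tau> S u) + cscale (of_real \<kappa>) (backward_\<kappa> S u)" for u
    by (auto simp: perturbation_def cscale_def)
  have W: "cfun.subspace (vecs ?W)"
    using normed_spaces by (simp add: is_normed_space_def)
  obtain C1 C2 where C: "\<And>u. u \<in> vecs ?V \<Longrightarrow> nrm ?W (backward_\<tau> S u) \<le> C1 * nrm ?V u"
    "\<And>u. u \<in> vecs ?V \<Longrightarrow> nrm ?W (backward_\<kappa> S u) \<le> C2 * nrm ?V u"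
    using bounded_operators(3,4) unfolding bounded_operator_def by blast
  have mem: "cscale c (backward_\<tau> S u) \<in> vecs ?W" "cscale c (backward_\<kappa> S u) \<in> vecs ?W"
    if "u \<in> vecs ?V" for u c
    using rhs_mem[OF that] cfun.subspace_scale[OF W] by auto
  have "nrm ?W (perturbation S \<kappa> \<tau> u) \<le> (\<bar>\<tau>\<bar> * C1 + \<bar>\<kappa>\<bar> * C2) * nrm ?V u" if u: "u \<in> vecs ?V" for u
  proof -
    have "nrm ?W (perturbation S \<kappa> \<tau> u) \<le> nrm ?W (cscale (of_real \<tau>) (backward_\<tau> S u))
        + nrm ?W (cscale (of_real \<kappa>) (backward_\<kappa> S u))"
      unfolding eq by (intro nrm_triangle normed_spaces mem u)
    also have "\<dots> = \<bar>\<tau>\<bar> * nrm ?W (backward_\<tau> S u) + \<bar>\<kappa>\<bar> * nrm ?W (backward_\<kappa> S u)"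
      using normed_spaces(3) rhs_mem[OF u] by (simp add: is_normed_space_def)
    also have "\<dots> \<le> \<bar>\<tau>\<bar> * (C1 * nrm ?V u) + \<bar>\<kappa>\<bar> * (C2 * nrm ?V u)"
      using C[OF u] by (intro add_mono mult_left_mono) auto
    finally show ?thesis
      by (simp add: algebra_simps)
  qed
  then show ?thesis
    unfolding bounded_operator_def using cfun.subspace_add[OF W] mem by (auto simp: eq)
qed

section \<open>Product modes of the uncoupled pair\<close>

lemma joint_modes_mem:
  "px \<in> vecs (joint_fwd X)" "py \<in> vecs (joint_fwd X)"
  "qx \<in> vecs (joint_bwd X)" "qy \<in> vecs (joint_bwd X)"
proof -
  have prod: "(\<lambda>(x, y). p x * q y) \<in> vecs (joint_fwd X)"
    if "p \<in> osc_fwd X" "q \<in> osc_fwd X" for p q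
    using setting that by (auto simp: admissible_setting_def)
  show "px \<in> vecs (joint_fwd X)"
    using prod[OF modes_mem(1) modes_mem(1)] by (simp add: P1x_def)
  show "py \<in> vecs (joint_fwd X)"
    using prod[OF modes_mem(1)[of 0] modes_mem(1)[of 1]] by (simp add: P1y_def mult.commute)
  show "qx \<in> vecs (joint_bwd X)" "qy \<in> vecs (joint_bwd X)"
    using setting modes_mem by (auto simp: admissible_setting_def Q1x_def Q1y_def)
qed

text \<open>The generator of the other oscillator annihilates a function that does not depend on its
  variable; equal noise gives both modes the same eigenvalue.\<close>

lemma backward_modes: "backward S 0 0 qx = cscale (lam 1) qx" "backward S 0 0 qy = cscale (lam 1) qy"
  by (auto simp: fun_eq_iff backward_def perturbation_def backward_x_def backward_y_def Q1x_def
      Q1y_def cscale_def modes_eigen simp flip: identical)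

text \<open>The eigenvalues of the two factors add up, and the stationary factor \<open>P 0\<close>
  contributes \<open>lam 0 = 0\<close>.\<close>

lemma forward_modes: "forward S 0 0 px = cscale (lam 1) px" "forward S 0 0 py = cscale (lam 1) py"
proof -
  have reg: "C2 (drift S)" "\<And>i j. C2 (\<lambda>x. noise_x S x $ i $ j)"
    using regular by (auto simp: regular_system_def)
  have left: "osc_forward (drift S) (noise_x S) (\<lambda>x. c * P k x) x = c * (lam k * P k x)" for c k x
    by (simp add: osc_forward_cmult[OF reg P_C2] modes_eigen)
  have right: "osc_forward (drift S) (noise_x S) (\<lambda>x. P k x * c) x = c * (lam k * P k x)" for c k x
    using left by (simp add: mult.commute)
  show "forward S 0 0 px = cscale (lam 1) px" "forward S 0 0 py = cscale (lam 1) py"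
    using modes_0(1)
    by (auto simp: fun_eq_iff forward_def forward_x_def forward_y_def P1x_def P1y_def cscale_def
        left right simp flip: identical)
qed

lemma pairing_separated:
  assumes "u \<in> vecs (rhs_bwd X)" "v \<in> vecs (joint_fwd X)"
    and "\<And>x y. u (x, y) * v (x, y) = a x * b y"
  shows "pairing u v = (LINT x|lborel. a x) * (LINT y|lborel. b y)"
  using pairable_mem[OF assms(1,2)] assms(3) unfolding pairing_def pairable_def
  by (intro integral_separated) auto

text \<open>All four double integrals separate: the cross terms contain the mass of
  \<open>P 1\<close>, which is 0, and the diagonal ones are the normalization of \<open>Q 1\<close>
  and \<open>P 1\<close> times the mass 1 of \<open>P 0\<close>.\<close>

lemma pairing_modes: "pairing qx px = 1" "pairing qy px = 0" "pairing qx py = 0" "pairing qy py = 1"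
proof -
  note mem = joint_modes_mem(1,2) joint_modes_mem(3,4)[THEN rhs_mem(1)]
  note defs = Q1x_def Q1y_def P1x_def P1y_def
  have "pairing qx px = (LINT x|lborel. Q 1 x * P 1 x) * (LINT y|lborel. P 0 y)"
    by (rule pairing_separated[OF mem(3) mem(1)]) (simp add: defs)
  then show "pairing qx px = 1"
    by (simp add: modes_pairing modes_0)
  have "pairing qy px = (LINT x|lborel. P 1 x) * (LINT y|lborel. Q 1 y * P 0 y)"
    by (rule pairing_separated[OF mem(4) mem(1)]) (simp add: defs)
  then show "pairing qy px = 0"
    by (simp add: integral_P1)
  have "pairing qx py = (LINT x|lborel. Q 1 x * P 0 x) * (LINT y|lborel. P 1 y)"
    by (rule pairing_separated[OF mem(3) mem(2)]) (simp add: defs)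
  then show "pairing qx py = 0"
    by (simp add: integral_P1)
  have "pairing qy py = (LINT x|lborel. P 0 x) * (LINT y|lborel. Q 1 y * P 1 y)"
    by (rule pairing_separated[OF mem(4) mem(2)]) (simp add: defs)
  then show "pairing qy py = 1"
    by (simp add: modes_pairing modes_0)
qed

section \<open>Orthogonality of the range and the degenerate eigenspace\<close>

text \<open>Stands in for integration by parts: the equation with this right-hand side is solved by
  \<open>u\<close> itself, so the solvability condition of the Fredholm alternative must
  hold.\<close>

lemma fredholm_orthogonal:
  assumes u: "u \<in> vecs (joint_bwd X)" and v: "v \<in> vecs (joint_fwd X)"
    and ev: "forward S 0 0 v = cscale l v"
  shows "pairing (backward S 0 0 u - cscale l u) v = 0"
proof -
  have "backward S 0 0 u - cscale l u \<in> vecs (rhs_bwd X)"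
    using rhs_mem[OF u] normed_spaces(3)
    by (auto simp: is_normed_space_def intro: cfun.subspace_diff cfun.subspace_scale)
  moreover have "fredholm_alternative (vecs (joint_bwd X)) (vecs (rhs_bwd X))
      (\<lambda>u. backward S 0 0 u - cscale l u) (vecs (joint_fwd X)) (\<lambda>p. forward S 0 0 p - cscale l p)"
    using criterion_A unfolding coupled_criterion_A_def by blast
  then have "\<forall>f\<in>vecs (rhs_bwd X). (\<exists>u\<in>vecs (joint_bwd X). backward S 0 0 u - cscale l u = f) \<longrightarrow>
      (\<forall>v\<in>vecs (joint_fwd X). forward S 0 0 v - cscale l v = 0 \<longrightarrow> pairing f v = 0)"
    unfolding fredholm_alternative_def by blast
  moreover have "forward S 0 0 v - cscale l v = 0"
    by (simp add: ev)
  ultimately show ?thesis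
    using u v by blast
qed

text \<open>The multiplicity is two, and \<open>qx\<close> and \<open>qy\<close> are independent
  because pairing with \<open>px\<close> separates them.\<close>

lemma eigenspace_lam1:
  assumes "u \<in> eigenspace (vecs (joint_bwd X)) (backward S 0 0) (lam 1)"
  obtains a b where "u = (\<lambda>z. a * qx z + b * qy z)"
proof -
  let ?E = "eigenspace (vecs (joint_bwd X)) (backward S 0 0) (lam 1)"
  have "qx \<noteq> cscale k qy" for k
  proof
    assume "qx = cscale k qy"
    then have "pairing qx px = k * pairing qy px"
      by (simp add: pairing_def cscale_def mult.assoc)
    then show False
      by (simp add: pairing_modes)
  qed
  then have "qx \<notin> cfun.span {qy}"
    by (auto simp: cfun.span_singleton)
  moreover have "qy \<noteq> 0"
    using pairing_modes(4) by (auto simp: pairing_def)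
  ultimately have "cfun.independent {qx, qy}" "qx \<noteq> qy"
    by (auto simp: cfun.independent_insert intro: cfun.span_base)
  moreover have "qx \<in> ?E" "qy \<in> ?E"
    using joint_modes_mem backward_modes by (auto simp: eigenspace_def)
  ultimately have "u \<in> cfun.span {qx, qy}"
    using assms multiplicity_2 unfolding multiplicity_of_def
    by (intro cfun.two_independent_span) auto
  then obtain a b where "u - cscale a qx = cscale b qy"
    by (auto simp: cfun.span_breakdown_eq[of _ qx] cfun.span_singleton)
  then have "u = (\<lambda>z. a * qx z + b * qy z)"
    by (auto simp: fun_eq_iff cscale_def algebra_simps)
  then show thesis
    by (rule that)
qed

text \<open>The eigenvalue equation on the ray expresses the unperturbed operator minus
  \<open>l0\<close>, applied to \<open>u\<close>, through \<open>u\<close> and the perturbation of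
  \<open>u\<close>; pairing with the forward eigenfunction \<open>v\<close> kills that side. The
  identity is exact in \<open>\<epsilon>\<close>.\<close>

lemma pairing_eigen:
  assumes u: "u \<in> eigenspace (vecs (joint_bwd X)) (backward S (\<epsilon> * \<kappa>) (\<epsilon> * \<tau>)) l"
    and v: "v \<in> vecs (joint_fwd X)" and ev: "forward S 0 0 v = cscale l0 v"
  shows "(l - l0) * pairing u v = of_real \<epsilon> * pairing (perturbation S \<kappa> \<tau> u) v"
proof -
  have mem: "u \<in> vecs (joint_bwd X)" and eq: "backward S (\<epsilon> * \<kappa>) (\<epsilon> * \<tau>) u = cscale l u"
    using u by (auto simp: eigenspace_def)
  have "backward S 0 0 u z = l * u z - of_real \<epsilon> * perturbation S \<kappa> \<tau> u z" for z
    using fun_cong[OF eq, of z] by (simp add: backward_ray[of S \<epsilon>] cscale_def algebra_simps)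
  then have "backward S 0 0 u - cscale l0 u
      = (\<lambda>z. (l - l0) * u z + (- of_real \<epsilon>) * perturbation S \<kappa> \<tau> u z)"
    by (auto simp: cscale_def algebra_simps)
  moreover have "pairable u v" "pairable (perturbation S \<kappa> \<tau> u) v"
    using rhs_mem(1)[OF mem] bounded_perturbation mem
    by (auto intro!: pairable_mem v simp: bounded_operator_def)
  ultimately have "(l - l0) * pairing u v + (- of_real \<epsilon>) * pairing (perturbation S \<kappa> \<tau> u) v = 0"
    using fredholm_orthogonal[OF mem v ev] by (simp only: pairing_lincomb)
  then show ?thesis
    by simp
qed

section \<open>Entries and discriminant of the splitting matrix\<close>

definition Mxx :: "real \<Rightarrow> real \<Rightarrow> complex" where
  "Mxx \<kappa> \<tau> = pairing (perturbation S \<kappa> \<tau> qx) px"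

definition Myy :: "real \<Rightarrow> real \<Rightarrow> complex" where
  "Myy \<kappa> \<tau> = pairing (perturbation S \<kappa> \<tau> qy) py"

abbreviation "\<beta> \<equiv> beta S (P 0) (P 1) (Q 1)"

lemma pairing_perturbation:
  assumes "u \<in> vecs (joint_bwd X)" "v \<in> vecs (joint_fwd X)"
  shows "pairing (perturbation S \<kappa> \<tau> u) v
    = of_real \<tau> * pairing (backward_\<tau> S u) v + of_real \<kappa> * pairing (backward_\<kappa> S u) v"
proof -
  have "pairable (backward_\<tau> S u) v" "pairable (backward_\<kappa> S u) v"
    using rhs_mem[OF assms(1)] assms(2) by (auto intro: pairable_mem)
  from pairing_lincomb[OF this] show ?thesis
    by (simp add: perturbation_def[abs_def])
qed

text \<open>Detuning acts on each oscillator separately, so the integrals separate and contain the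
  mass of \<open>P 1\<close>, which is 0.\<close>

lemma pairing_detuning_off_diagonal:
  "pairing (backward_\<tau> S qy) px = 0" "pairing (backward_\<tau> S qx) py = 0"
proof -
  note mem = joint_modes_mem(1,2) joint_modes_mem(3,4)[THEN rhs_mem(3)]
  note defs = Q1x_def Q1y_def P1x_def P1y_def backward_\<tau>_def
  have "pairing (backward_\<tau> S qy) px
      = (LINT x|lborel. P 1 x) * (LINT y|lborel. transport (detune_y S) (Q 1) y * P 0 y)"
    by (rule pairing_separated[OF mem(4) mem(1)]) (simp add: defs)
  then show "pairing (backward_\<tau> S qy) px = 0"
    by (simp add: integral_P1)
  have "pairing (backward_\<tau> S qx) py
      = (LINT x|lborel. transport (detune_x S) (Q 1) x * P 0 x) * (LINT y|lborel. P 1 y)"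
    by (rule pairing_separated[OF mem(3) mem(2)]) (simp add: defs)
  then show "pairing (backward_\<tau> S qx) py = 0"
    by (simp add: integral_P1)
qed

text \<open>Exchanging \<open>x\<close> and \<open>y\<close> interchanges the two terms of
  \<open>backward_\<kappa>\<close>, as well as \<open>qx\<close> with \<open>qy\<close> and
  \<open>px\<close> with \<open>py\<close>, and it preserves the integral.\<close>

lemma pairing_coupling_swap:
  "pairing (backward_\<kappa> S qy) py = pairing (backward_\<kappa> S qx) px"
  "pairing (backward_\<kappa> S qx) py = \<beta>" "pairing (backward_\<kappa> S qy) px = \<beta>"
proof -
  have int: "integrable lborel (\<lambda>z. backward_\<kappa> S u z * v z)"
    if "u \<in> vecs (joint_bwd X)" "v \<in> vecs (joint_fwd X)" for u v
    using pairable_mem[OF rhs_mem(4)[OF that(1)] that(2)] by (simp add: pairable_def)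
  note sw = integral_swap[OF int]
  note m = joint_modes_mem
  note defs = pairing_def Q1x_def Q1y_def P1x_def P1y_def backward_\<kappa>_def case_prod_beta
  show "pairing (backward_\<kappa> S qy) py = pairing (backward_\<kappa> S qx) px"
    using sw[OF m(4) m(2)] by (simp add: defs)
  show \<beta>: "pairing (backward_\<kappa> S qy) px = \<beta>"
    by (simp add: pairing_def beta_def mult.commute)
  show "pairing (backward_\<kappa> S qx) py = \<beta>"
    using sw[OF m(3) m(2)] unfolding \<beta>[symmetric] by (simp add: defs)
qed

lemma pairing_off_diagonal:
  "pairing (perturbation S \<kappa> \<tau> qy) px = of_real \<kappa> * \<beta>"
  "pairing (perturbation S \<kappa> \<tau> qx) py = of_real \<kappa> * \<beta>"
  by (simp_all add: pairing_perturbation joint_modes_mem pairing_detuning_off_diagonal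
      pairing_coupling_swap)

text \<open>By the exchange symmetry the coupling contributes equally to both diagonal entries and
  drops out.\<close>

lemma Mxx_minus_Myy:
  "Mxx \<kappa> \<tau> - Myy \<kappa> \<tau> = of_real \<tau> *
     (LINT z|lborel. px z * backward_\<tau> S qx z - py z * backward_\<tau> S qy z)"
proof -
  have "pairable (backward_\<tau> S qx) px" "pairable (backward_\<tau> S qy) py"
    using rhs_mem(3) joint_modes_mem by (auto intro: pairable_mem)
  then have eq: "(LINT z|lborel. px z * backward_\<tau> S qx z - py z * backward_\<tau> S qy z)
      = pairing (backward_\<tau> S qx) px - pairing (backward_\<tau> S qy) py"
    by (simp add: pairable_def pairing_def mult.commute)
  show ?thesis
    unfolding eq by (simp add: Mxx_def Myy_def pairing_perturbation joint_modes_mem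
        pairing_coupling_swap right_diff_distrib)
qed

lemma splitting_matrix_eq:
  "splitting_matrix S (P 0) (P 1) (Q 1) \<kappa> \<tau>
    = vector [vector [Mxx \<kappa> \<tau>, of_real \<kappa> * \<beta>], vector [of_real \<kappa> * \<beta>, Myy \<kappa> \<tau>]]"
proof -
  have "splitting_matrix S (P 0) (P 1) (Q 1) \<kappa> \<tau>
    = vector [vector [pairing (perturbation S \<kappa> \<tau> qx) px, pairing (perturbation S \<kappa> \<tau> qy) px],
        vector [pairing (perturbation S \<kappa> \<tau> qx) py, pairing (perturbation S \<kappa> \<tau> qy) py]]"
    by (simp add: splitting_matrix_def pairing_def mult.commute)
  then show ?thesis
    by (simp add: pairing_off_diagonal Mxx_def Myy_def)
qed

lemma Upsilon_eq: "Upsilon S (P 0) (P 1) (Q 1) \<kappa> \<tau> = (Mxx \<kappa> \<tau> + Myy \<kappa> \<tau>) / 2"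
  by (simp add: Upsilon_def splitting_matrix_eq trace_def sum_2)

text \<open>For a symmetric matrix the squared trace minus four determinants is the squared
  difference of the diagonal entries plus four times the squared off-diagonal entry.\<close>

lemma splitting_discriminant_eq:
  "splitting_discriminant S (P 0) (P 1) (Q 1) \<kappa> \<tau>
    = csqrt ((Mxx \<kappa> \<tau> - Myy \<kappa> \<tau>)\<^sup>2 + 4 * (of_real \<kappa> * \<beta>)\<^sup>2)"
  by (simp add: splitting_discriminant_def splitting_matrix_eq trace_def sum_2 det_2
      power2_eq_square algebra_simps)

text \<open>Clearing the denominator \<open>2 * \<beta>\<close> and squaring removes the sign
  \<open>s\<close>, the absolute value of \<open>\<tau>\<close> and the choice of root in
  \<open>csqrt\<close>; the factor \<open>\<i>\<close> supplies the minus sign that cancels the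
  detuning term.\<close>

lemma critical_coupling:
  assumes "\<beta> \<noteq> 0" "s \<in> {1, -1}" "of_real \<kappa> = frak_K s S (P 0) (P 1) (Q 1) \<tau>"
  shows "(Mxx \<kappa> \<tau> - Myy \<kappa> \<tau>)\<^sup>2 + 4 * (of_real \<kappa> * \<beta>)\<^sup>2 = 0"
proof -
  define I where "I = (LINT z|lborel. px z * backward_\<tau> S qx z - py z * backward_\<tau> S qy z)"
  have "2 * (of_real \<kappa> * \<beta>) = s * \<i> * of_real \<bar>\<tau>\<bar> * csqrt (I\<^sup>2)"
    using assms(1) unfolding assms(3) frak_K_def I_def by simp
  then have "(2 * (of_real \<kappa> * \<beta>))\<^sup>2 = s\<^sup>2 * \<i>\<^sup>2 * (of_real \<bar>\<tau>\<bar>)\<^sup>2 * (csqrt (I\<^sup>2))\<^sup>2"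
    by (simp only: power_mult_distrib)
  also have "\<dots> = - ((of_real \<tau>)\<^sup>2 * I\<^sup>2)"
    using assms(2) by (auto simp flip: of_real_power)
  finally show ?thesis
    by (simp add: Mxx_minus_Myy I_def power_mult_distrib)
qed

section \<open>Expansion of the eigenvalue branches\<close>

text \<open>The pairings of the branch with \<open>px\<close> and \<open>py\<close> feed
  \<open>degenerate_expansion\<close>. The coefficient does not depend on the vector through which
  the branch leaves the eigenspace, so every branch starting at \<open>lam 1\<close> gets the same
  one.\<close>

lemma branch_expansion:
  assumes branches: "spectral_branches S X \<kappa> \<tau> \<Lambda> Pb Qb" and k: "\<Lambda> k 0 = lam 1"
    and disc: "(Mxx \<kappa> \<tau> - Myy \<kappa> \<tau>)\<^sup>2 + 4 * (of_real \<kappa> * \<beta>)\<^sup>2 = 0"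
  shows "(\<lambda>\<epsilon>. \<Lambda> k \<epsilon> - (lam 1 + of_real \<epsilon> * Upsilon S (P 0) (P 1) (Q 1) \<kappa> \<tau>))
    \<in> O[at 0](\<lambda>\<epsilon>. (of_real \<epsilon>)\<^sup>2)"
proof -
  let ?B = "perturbation S \<kappa> \<tau>"
  have curve: "C1_curve (joint_bwd X) (Qb k)"
    and eig: "\<And>\<epsilon>. \<epsilon> \<in> {-1..1} \<Longrightarrow> Qb k \<epsilon>
      \<in> eigenspace (vecs (joint_bwd X)) (backward S (\<epsilon> * \<kappa>) (\<epsilon> * \<tau>)) (\<Lambda> k \<epsilon>) - {0}"
    using branches by (auto simp: spectral_branches_def)
  have "Qb k 0 \<in> eigenspace (vecs (joint_bwd X)) (backward S 0 0) (lam 1)" "Qb k 0 \<noteq> 0"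
    using eig[of 0] k by auto
  then obtain a b where ab: "Qb k 0 = (\<lambda>z. a * qx z + b * qy z)"
    by (elim eigenspace_lam1)
  with \<open>Qb k 0 \<noteq> 0\<close> have nz: "a \<noteq> 0 \<or> b \<noteq> 0"
    by (auto simp: fun_eq_iff)
  have B0: "?B (Qb k 0) = (\<lambda>z. a * ?B qx z + b * ?B qy z)"
    by (rule ext) (simp add: ab perturbation_lincomb joint_differentiable joint_modes_mem)
  have Bdiff: "?B (f - g) = ?B f - ?B g"
    if "f \<in> vecs (joint_bwd X)" "g \<in> vecs (joint_bwd X)" for f g
  proof -
    \<comment> \<open>A difference is written as a linear combination with coefficients
      \<open>1\<close> and \<open>- 1\<close> to fit \<open>perturbation_lincomb\<close>.\<close>
    have "f - g = (\<lambda>z. 1 * f z + - 1 * g z)"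
      by (simp add: fun_eq_iff)
    then have "?B (f - g) z = 1 * ?B f z + - 1 * ?B g z" for z
      by (simp only: perturbation_lincomb joint_differentiable that)
    then show ?thesis
      by (simp add: fun_eq_iff)
  qed
  have pairable: "pairable u v" "pairable (?B u) v"
    if "u \<in> vecs (joint_bwd X)" "v \<in> vecs (joint_fwd X)" for u v
    using rhs_mem(1)[OF that(1)] bounded_perturbation that
    by (auto intro!: pairable_mem simp: bounded_operator_def)
  note lin = pairing_lincomb[OF pairable(1) pairable(1)] pairing_lincomb[OF pairable(2) pairable(2)]
  have near: "\<forall>\<^sub>F \<epsilon> in at 0. \<epsilon> \<in> {-1..1::real}"
    by (rule eventually_mono[OF eventually_at_in_open'[of "{-1<..<1}"]]) auto
  have eq: "\<forall>\<^sub>F \<epsilon> in at 0. (\<Lambda> k \<epsilon> - lam 1) * pairing (Qb k \<epsilon>) v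
      = of_real \<epsilon> * pairing (?B (Qb k \<epsilon>)) v"
    if "v \<in> vecs (joint_fwd X)" "forward S 0 0 v = cscale (lam 1) v" for v
    using near by eventually_elim (use eig that in \<open>auto intro!: pairing_eigen\<close>)
  have bigo_id: "(\<lambda>\<epsilon>. pairing (Qb k \<epsilon>) v - pairing (Qb k 0) v) \<in> O[at 0](of_real)"
    if "v \<in> vecs (joint_fwd X)" for v
    by (rule pairing_curve_bigo[OF normed_spaces(1,3,2) bounded_operators(1) bounded_pairing_bwd
          refl curve that])
  have bigo_B: "(\<lambda>\<epsilon>. pairing (?B (Qb k \<epsilon>)) v - pairing (?B (Qb k 0)) v) \<in> O[at 0](of_real)"
    if "v \<in> vecs (joint_fwd X)" for v
    by (rule pairing_curve_bigo[OF normed_spaces(1,3,2) bounded_perturbation bounded_pairing_bwd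
          Bdiff curve that])
  have pair_Q0: "pairing (Qb k 0) v = a * pairing qx v + b * pairing qy v"
    if "v \<in> vecs (joint_fwd X)" for v
    unfolding ab by (rule lin(1)[OF joint_modes_mem(3) that joint_modes_mem(4) that])
  have pair_B0: "pairing (?B (Qb k 0)) v = a * pairing (?B qx) v + b * pairing (?B qy) v"
    if "v \<in> vecs (joint_fwd X)" for v
    unfolding B0 by (rule lin(2)[OF joint_modes_mem(3) that joint_modes_mem(4) that])
  \<comment> \<open>Biorthonormality turns the pairings at 0 into the coordinates
    \<open>(a, b)\<close> and into the image of \<open>(a, b)\<close> under the symmetric splitting
    matrix.\<close>
  have at_0: "pairing (Qb k 0) px = a" "pairing (Qb k 0) py = b"
    "pairing (?B (Qb k 0)) px = a * Mxx \<kappa> \<tau> + b * (of_real \<kappa> * \<beta>)"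
    "pairing (?B (Qb k 0)) py = a * (of_real \<kappa> * \<beta>) + b * Myy \<kappa> \<tau>"
    by (simp_all add: pair_Q0 pair_B0 joint_modes_mem pairing_modes pairing_off_diagonal Mxx_def Myy_def)
  have "(\<lambda>\<epsilon>. (\<Lambda> k \<epsilon> - lam 1) - of_real \<epsilon> * ((Mxx \<kappa> \<tau> + Myy \<kappa> \<tau>) / 2))
      \<in> O[at 0](\<lambda>\<epsilon>. (of_real \<epsilon>)\<^sup>2)"
    by (rule degenerate_expansion[OF eq[OF joint_modes_mem(1) forward_modes(1)]
          eq[OF joint_modes_mem(2) forward_modes(2)]
          bigo_id[OF joint_modes_mem(1), unfolded at_0] bigo_id[OF joint_modes_mem(2), unfolded at_0]
          bigo_B[OF joint_modes_mem(1), unfolded at_0] bigo_B[OF joint_modes_mem(2), unfolded at_0]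
          nz disc])
  then show ?thesis
    by (simp add: Upsilon_eq diff_diff_eq)
qed

end

theorem corollary3p2:
  fixes S :: "('n::finite, 'm::finite) coupled_system"
    and X :: "'n function_setting"
    and K T :: "real set"
    and lam :: "nat \<Rightarrow> complex"
    and P Q :: "nat \<Rightarrow> real^'n \<Rightarrow> complex"
    and s :: complex
    and \<kappa>s \<tau>s :: real
    and lam_plus lam_minus :: "real \<Rightarrow> real \<Rightarrow> complex"
    and Q_plus Q_minus :: "real \<Rightarrow> real \<Rightarrow> (real^'n) \<times> (real^'n) \<Rightarrow> complex"
  assumes "regular_system S"
    and "noise_x S = noise_y S"
    and "admissible_setting S X"
    and "coupled_criterion_A S X"
    and "coupled_criterion_B S X K T"
    and "unperturbed_modes S X lam P Q"
    and "beta S (P 0) (P 1) (Q 1) \<noteq> 0"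
    and "\<kappa>s \<in> K" and "\<tau>s \<in> T"
    and "s \<in> {1, -1}"
    and "of_real \<kappa>s = frak_K s S (P 0) (P 1) (Q 1) \<tau>s"
    and "perturbed_pair S X (lam 1) \<kappa>s \<tau>s lam_plus lam_minus Q_plus Q_minus"
  shows "splitting_discriminant S (P 0) (P 1) (Q 1) \<kappa>s \<tau>s = 0 \<and>
    (\<lambda>\<epsilon>. lam_plus (\<epsilon> * \<kappa>s) (\<epsilon> * \<tau>s)
        - (lam 1 + of_real \<epsilon> * Upsilon S (P 0) (P 1) (Q 1) \<kappa>s \<tau>s))
      \<in> O[at 0](\<lambda>\<epsilon>. (of_real \<epsilon>)\<^sup>2) \<and>
    (\<lambda>\<epsilon>. lam_minus (\<epsilon> * \<kappa>s) (\<epsilon> * \<tau>s)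
        - (lam 1 + of_real \<epsilon> * Upsilon S (P 0) (P 1) (Q 1) \<kappa>s \<tau>s))
      \<in> O[at 0](\<lambda>\<epsilon>. (of_real \<epsilon>)\<^sup>2)"
proof -
  interpret identical_oscillators S X lam P Q
    by unfold_locales (fact assms)+
  obtain \<Lambda> Pb Qb i j where branches: "spectral_branches S X \<kappa>s \<tau>s \<Lambda> Pb Qb"
    and ij: "{k. \<Lambda> k 0 = lam 1} = {i, j}"
    and pm: "\<And>\<epsilon>. \<epsilon> \<in> {-1..1} \<Longrightarrow> lam_plus (\<epsilon> * \<kappa>s) (\<epsilon> * \<tau>s) = \<Lambda> i \<epsilon>
      \<and> lam_minus (\<epsilon> * \<kappa>s) (\<epsilon> * \<tau>s) = \<Lambda> j \<epsilon>"
    using \<open>perturbed_pair S X (lam 1) \<kappa>s \<tau>s lam_plus lam_minus Q_plus Q_minus\<close>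
    unfolding perturbed_pair_def by blast
  have disc: "(Mxx \<kappa>s \<tau>s - Myy \<kappa>s \<tau>s)\<^sup>2 + 4 * (of_real \<kappa>s * \<beta>)\<^sup>2 = 0"
    by (rule critical_coupling) fact+
  have near: "\<forall>\<^sub>F \<epsilon> in at 0. \<epsilon> \<in> {-1..1::real}"
    by (rule eventually_mono[OF eventually_at_in_open'[of "{-1<..<1}"]]) auto
  \<comment> \<open>\<open>lam_plus\<close> and \<open>lam_minus\<close> agree with branches only
    for \<open>\<epsilon>\<close> in \<open>{-1..1}\<close>; that is enough, since the estimate
    concerns \<open>\<epsilon>\<close> near 0.\<close>
  have transfer: "(\<lambda>\<epsilon>. l \<epsilon> - (lam 1 + of_real \<epsilon> * Upsilon S (P 0) (P 1) (Q 1) \<kappa>s \<tau>s))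
      \<in> O[at 0](\<lambda>\<epsilon>. (of_real \<epsilon>)\<^sup>2)"
    if "\<And>\<epsilon>. \<epsilon> \<in> {-1..1} \<Longrightarrow> l \<epsilon> = \<Lambda> k \<epsilon>" "\<Lambda> k 0 = lam 1" for k and l :: "real \<Rightarrow> complex"
  proof -
    have "\<forall>\<^sub>F \<epsilon> in at 0. l \<epsilon> - (lam 1 + of_real \<epsilon> * Upsilon S (P 0) (P 1) (Q 1) \<kappa>s \<tau>s)
        = \<Lambda> k \<epsilon> - (lam 1 + of_real \<epsilon> * Upsilon S (P 0) (P 1) (Q 1) \<kappa>s \<tau>s)"
      using near by eventually_elim (simp add: that)
    from landau_o.big.in_cong[OF this] branch_expansion[OF branches that(2) disc] show ?thesis
      by (rule iffD2)
  qed
  have "i \<in> {k. \<Lambda> k 0 = lam 1}" "j \<in> {k. \<Lambda> k 0 = lam 1}"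
    unfolding ij by simp_all
  then have "\<Lambda> i 0 = lam 1" "\<Lambda> j 0 = lam 1"
    by simp_all
  then show ?thesis
    using transfer[of "\<lambda>\<epsilon>. lam_plus (\<epsilon> * \<kappa>s) (\<epsilon> * \<tau>s)" i]
      transfer[of "\<lambda>\<epsilon>. lam_minus (\<epsilon> * \<kappa>s) (\<epsilon> * \<tau>s)" j] pm disc
    by (simp add: splitting_discriminant_eq)
qed

end
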